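(* Let $M=U\oplus L$ be an even integral lattice of signature $(2,n)$ which splits a hyperbolic plane $U$, let $\Gamma\subset O^+(M)$ be a subgroup of finite index, and let $k\in\mathbb Z$, $s\ge 0$. The constant-term morphism $$\mathrm{ct}:\mathsf{AHMod}_{k,s}(\Gamma)\to\mathsf{QMod}_{k,s}(\Gamma),\qquad F\mapsto F|_{\nu_1=\cdots=\nu_n=0},$$ which sends an almost-holomorphic orthogonal modular form to its associated quasimodular form, is an isomorphism.
   Context: Let $U=\mathbb Ze\oplus\mathbb Zf$ with $\langle e,e\rangle=\langle f,f\rangle=0$, $\langle e,f\rangle=1$, so $L$ has signature $(1,n-1)$. $\mathcal D$ is a connected component of $\{[Z]\in\mathbb P(M_{\mathbb C}):\langle Z,Z\rangle=0,\ \langle Z,\overline Z\rangle>0\}$ and $O^+(M)\subset O(M)$ is the subgroup preserving $\mathcal D$. The tube domain $\mathcal C$ is the component of $\{z\in L_{\mathbb C}:\langle \mathrm{Im}\,z,\mathrm{Im}\,z\rangle>0\}$ mapped biholomorphically to $\mathcal D$ by $z\mapsto[\widetilde\varphi(z)]$, $\widetilde\varphi(z)=-\tfrac12\langle z,z\rangle e+z+f$. For $\gamma\in O^+(M)$ the action $z\mapsto\gamma z$ on $\mathcal C$ and the factor $J(\gamma,z)\in\mathbb C^*$ are defined by $\gamma\,\widetilde\varphi(z)=J(\gamma,z)\widetilde\varphi(\gamma z)$. Fix a basis $e_1,\dots,e_n$ of $L$ with coordinates $z=\sum z_ie_i$, Gram matrix $g_{ij}=\langle e_i,e_j\rangle$.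 Put $\lambda(\gamma,z)_{ij}=J(\gamma,z)\,\partial(\gamma z)_i/\partial z_j$, and for $F:\mathcal C\to(\mathbb C^n)^{\otimes s}$ $$(F|_{k,s}\gamma)(z)_{j_1\dots j_s}=J(\gamma,z)^{-k}\sum_{i_1,\dots,i_s}F_{i_1\dots i_s}(\gamma z)\lambda_{i_1j_1}(\gamma,z)\cdots\lambda_{i_sj_s}(\gamma,z).$$ Let $\nu_j=\frac{\partial}{\partial z_j}\log(\mathrm{Im}(z)^2)$, where $\mathrm{Im}(z)^2=\langle\mathrm{Im}\,z,\mathrm{Im}\,z\rangle$. $\mathsf{AHMod}_{k,s}(\Gamma)$ (almost-holomorphic modular forms of weight $k$ and rank $s$) is identified with the space of smooth $F:\mathcal C\to(\mathbb C^n)^{\otimes s}$ with $F|_{k,s}\gamma=F$ for all $\gamma\in\Gamma$ such that every component $F_{i_1\dots i_s}$ is a polynomial in $\nu_1,\dots,\nu_n$ with holomorphic functions on $\mathcal C$ as coefficients. (Equivalently: $\Gamma$-invariant smooth sections of $\mathcal L^{k}\otimes\mathcal E^{\otimes s}$ on $\mathcal D$ annihilated by some power of the lowering operator $\mathsf L$, where $\mathcal L|_{[Z]}=\mathbb CZ$, $\mathcal E|_{[Z]}=Z^\perp/\mathbb CZ$; in these coordinates $\mathsf L(F)_{i_1\dots i_s,a}=\frac12\sum_jg_{aj}\,\partial F_{i_1\dots i_s}/\partial\nu_j$.) If $n\le2$ one additionally requires a cusp condition: for every primitive isotropic $e'\in M$, choosing isotropic $f'\in M_{\mathbb Q}$ with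 $\langle e',f'\rangle=1$ and using the corresponding tube domain in $\{e',f'\}^\perp\otimes\mathbb C$, for every $d\ge0$ the holomorphic part (constant term as a polynomial in the corresponding $\nu_j$) of $\mathsf L^dF$ has a Fourier expansion $\sum_\alpha c_\alpha e^{2\pi i\alpha(z)}$ with $c_\alpha\ne0$ only for $\alpha$ in the closure of the component of the positive cone corresponding to the tube domain. (For $n\ge3$ this is automatic.) $\mathsf{QMod}_{k,s}(\Gamma)$ is the space of holomorphic functions $f:\mathcal C\to(\mathbb C^n)^{\otimes s}$ of the form $f=F|_{\nu_1=\cdots=\nu_n=0}$ (the constant term of $F$ as a polynomial in the $\nu_j$) for some $F\in\mathsf{AHMod}_{k,s}(\Gamma)$. *)

theory Defs
  imports
    "HOL-Analysis.Analysis"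
    "HOL-Algebra.Coset"
    "HOL-Library.Function_Algebras"
begin

text \<open>
  A lattice with a chosen basis is given by its Gram matrix. Thus \<open>L\<close> is \<open>int ^ 'n\<close> with Gram
  matrix \<open>G\<close>, and \<open>M = U \<oplus> L\<close> is \<open>int ^ 'n hyp\<close> with Gram matrix \<open>hyp_gram G\<close>; the
  coordinates at \<open>HE\<close>, \<open>HF\<close>, \<open>Lat i\<close> are those along \<open>e\<close>, \<open>f\<close>, \<open>e\<^sub>i\<close>.
\<close>

datatype 'n hyp = HE | HF | Lat 'n

lemma UNIV_hyp: "(UNIV :: 'n hyp set) = {HE, HF} \<union> range Lat"
  by (auto intro: hyp.exhaust)

instance hyp :: (finite) finite
  by standard (simp add: UNIV_hyp)

definition bilin :: "'a::comm_ring_1 ^ 'm ^ 'm \<Rightarrow> 'a ^ 'm \<Rightarrow> 'a ^ 'm \<Rightarrow> 'a" where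
  "bilin g x y = (\<Sum>i\<in>UNIV. \<Sum>j\<in>UNIV. g $ i $ j * x $ i * y $ j)"

definition hyp_gram :: "'a::zero_neq_one ^ 'n ^ 'n \<Rightarrow> 'a ^ 'n hyp ^ 'n hyp" where
  "hyp_gram g = (\<chi> a b. case (a, b) of
      (HE, HF) \<Rightarrow> 1
    | (HF, HE) \<Rightarrow> 1
    | (Lat i, Lat j) \<Rightarrow> g $ i $ j
    | _ \<Rightarrow> 0)"

definition even_lattice :: "int ^ 'm ^ 'm \<Rightarrow> bool" where
  "even_lattice S \<longleftrightarrow> transpose S = S \<and> (\<forall>x. even (bilin S x x))"

text \<open>Well defined by Sylvester's law of inertia; \<open>p + q = CARD('m)\<close> means nondegeneracy.\<close>

definition has_signature :: "real ^ 'm ^ 'm \<Rightarrow> nat \<Rightarrow> nat \<Rightarrow> bool" where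
  "has_signature S p q \<longleftrightarrow> (\<exists>P :: real ^ 'm ^ 'm. invertible P \<and>
     (let D = transpose P ** S ** P in
       (\<forall>i j. i \<noteq> j \<longrightarrow> D $ i $ j = 0) \<and>
       card {i. D $ i $ i > 0} = p \<and> card {i. D $ i $ i < 0} = q))"

abbreviation rmat :: "int ^ 'a ^ 'b \<Rightarrow> real ^ 'a ^ 'b" where
  "rmat \<equiv> map_matrix real_of_int"

abbreviation cmat :: "real ^ 'a ^ 'b \<Rightarrow> complex ^ 'a ^ 'b" where
  "cmat \<equiv> map_matrix complex_of_real"

text \<open>
  Subsets of \<open>\<P>(M\<^sub>\<complex>)\<close> are represented by their preimages in \<open>M\<^sub>\<complex> - {0}\<close>. As \<open>\<complex>\<^sup>*\<close> is connected,
  the components of \<open>period_cone g\<close> are exactly the preimages of the components of the projective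
  set. The number \<open>\<langle>Z, cnj Z\<rangle>\<close> is always real.
\<close>

definition period_cone :: "real ^ 'n ^ 'n \<Rightarrow> (complex ^ 'n hyp) set" where
  "period_cone g = {Z. bilin (cmat (hyp_gram g)) Z Z = 0 \<and>
     Re (bilin (cmat (hyp_gram g)) Z (\<chi> i. cnj (Z $ i))) > 0}"

definition im_vec :: "complex ^ 'n \<Rightarrow> real ^ 'n" where
  "im_vec z = (\<chi> i. Im (z $ i))"

definition phi :: "real ^ 'n ^ 'n \<Rightarrow> complex ^ 'n \<Rightarrow> complex ^ 'n hyp" where
  "phi g z = (\<chi> a. case a of
     HE \<Rightarrow> - (1/2) * bilin (cmat g) z z | HF \<Rightarrow> 1 | Lat i \<Rightarrow> z $ i)"

text \<open>
  Since \<open>z \<mapsto> [phi g z]\<close> maps the two components of \<open>{z. \<langle>Im z, Im z\<rangle> > 0}\<close> onto the two components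
  of the period domain, this is the component that is mapped to \<open>D\<close>.
\<close>

definition tube :: "real ^ 'n ^ 'n \<Rightarrow> (complex ^ 'n hyp) set \<Rightarrow> (complex ^ 'n) set" where
  "tube g D = {z. bilin g (im_vec z) (im_vec z) > 0 \<and> phi g z \<in> D}"

definition Oplus ::
    "int ^ 'n ^ 'n \<Rightarrow> (complex ^ 'n hyp) set \<Rightarrow> (int ^ 'n hyp ^ 'n hyp) monoid" where
  "Oplus G D =
    \<lparr>carrier = {\<gamma>. invertible \<gamma> \<and> transpose \<gamma> ** hyp_gram G ** \<gamma> = hyp_gram G \<and>
                 (\<lambda>Z. cmat (rmat \<gamma>) *v Z) ` D = D},
     mult = (**), one = mat 1\<rparr>"

text \<open>
  \<open>A *v phi g z = J g A z *s phi g' (act g A z)\<close>: comparing coordinates at \<open>HF\<close> and \<open>Lat i\<close> gives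
  the formulas below. Here \<open>A\<close> is an isometry from \<open>U \<oplus> (\<real>\<^sup>n, g)\<close> to \<open>U \<oplus> (\<real>\<^sup>n, g')\<close>;
  \<open>g' = g\<close> is the action of the orthogonal group, the general case serves to change the cusp.
\<close>

definition J :: "real ^ 'n ^ 'n \<Rightarrow> real ^ 'n hyp ^ 'n hyp \<Rightarrow> complex ^ 'n \<Rightarrow> complex" where
  "J g A z = (cmat A *v phi g z) $ HF"

definition act ::
    "real ^ 'n ^ 'n \<Rightarrow> real ^ 'n hyp ^ 'n hyp \<Rightarrow> complex ^ 'n \<Rightarrow> complex ^ 'n" where
  "act g A z = (\<chi> i. (cmat A *v phi g z) $ Lat i / J g A z)"

definition lam ::
    "real ^ 'n ^ 'n \<Rightarrow> real ^ 'n hyp ^ 'n hyp \<Rightarrow> complex ^ 'n \<Rightarrow> 'n \<Rightarrow> 'n \<Rightarrow> complex" where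
  "lam g A z i j = J g A z * deriv (\<lambda>t. act g A (z + axis j t) $ i) 0"

text \<open>
  A function \<open>C \<rightarrow> (\<complex>\<^sup>n)\<^sup>\<otimes>\<^sup>s\<close> is given by its components, indexed by lists of length \<open>s\<close>.
\<close>

type_synonym 'n tensor_fun = "complex ^ 'n \<Rightarrow> 'n list \<Rightarrow> complex"

definition supported :: "(complex ^ 'n) set \<Rightarrow> nat \<Rightarrow> 'n tensor_fun \<Rightarrow> bool" where
  "supported C s F \<longleftrightarrow> (\<forall>z I. z \<notin> C \<or> length I \<noteq> s \<longrightarrow> F z I = 0)"

definition slash ::
    "real ^ 'n ^ 'n \<Rightarrow> real ^ 'n hyp ^ 'n hyp \<Rightarrow> int \<Rightarrow> nat \<Rightarrow> 'n tensor_fun \<Rightarrow> 'n tensor_fun" where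
  "slash g A k s F = (\<lambda>z js. J g A z powi (- k) *
     (\<Sum>is | length is = s. F (act g A z) is * (\<Prod>r<s. lam g A z (is ! r) (js ! r))))"

definition wirtinger :: "'n \<Rightarrow> (complex ^ 'n \<Rightarrow> complex) \<Rightarrow> complex ^ 'n \<Rightarrow> complex" where
  "wirtinger j h z = 1/2 *
     (vector_derivative (\<lambda>t::real. h (z + axis j (of_real t))) (at 0)
      - \<i> * vector_derivative (\<lambda>t::real. h (z + axis j (\<i> * of_real t))) (at 0))"

definition nu :: "real ^ 'n ^ 'n \<Rightarrow> 'n \<Rightarrow> complex ^ 'n \<Rightarrow> complex" where
  "nu g j = wirtinger j (\<lambda>z. of_real (ln (bilin g (im_vec z) (im_vec z))))"

definition holo_on :: "(complex ^ 'n \<Rightarrow> complex) \<Rightarrow> (complex ^ 'n) set \<Rightarrow> bool" where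
  "holo_on h C \<longleftrightarrow> (\<forall>z\<in>C. \<exists>D. (h has_derivative D) (at z within C) \<and>
     (\<forall>c v. D (c *s v) = c * D v))"

text \<open>\<open>Ck_on m h C\<close> is only used for open \<open>C\<close>: \<open>h\<close> is of class \<open>C\<^sup>m\<close> in the real sense.\<close>

fun Ck_on :: "nat \<Rightarrow> ('a::real_normed_vector \<Rightarrow> 'b::real_normed_vector) \<Rightarrow> 'a set \<Rightarrow> bool" where
  "Ck_on 0 h C \<longleftrightarrow> continuous_on C h"
| "Ck_on (Suc m) h C \<longleftrightarrow> (\<forall>x\<in>C. h differentiable (at x)) \<and>
     (\<forall>v. Ck_on m (\<lambda>x. frechet_derivative h (at x) v) C)"

definition smooth_fun_on ::
    "('a::real_normed_vector \<Rightarrow> 'b::real_normed_vector) \<Rightarrow> 'a set \<Rightarrow> bool" where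
  "smooth_fun_on h C \<longleftrightarrow> (\<forall>m. Ck_on m h C)"

text \<open>
  A tensor of polynomials in \<open>\<nu>\<close>: \<open>a I \<alpha>\<close> is the coefficient of \<open>\<Prod>\<^sub>j \<nu>\<^sub>j ^ \<alpha> j\<close> in component \<open>I\<close>.
\<close>

type_synonym 'n nu_poly = "'n list \<Rightarrow> ('n \<Rightarrow> nat) \<Rightarrow> complex ^ 'n \<Rightarrow> complex"

definition nu_expansion ::
    "real ^ 'n ^ 'n \<Rightarrow> (complex ^ 'n) set \<Rightarrow> nat \<Rightarrow> 'n tensor_fun \<Rightarrow> 'n nu_poly \<Rightarrow> bool" where
  "nu_expansion g C s F a \<longleftrightarrow>
     (\<forall>I \<alpha> z. z \<notin> C \<or> length I \<noteq> s \<longrightarrow> a I \<alpha> z = 0) \<and>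
     (\<forall>I \<alpha>. holo_on (a I \<alpha>) C) \<and>
     (\<forall>I. finite {\<alpha>. a I \<alpha> \<noteq> (\<lambda>_. 0)}) \<and>
     (\<forall>z\<in>C. \<forall>I. length I = s \<longrightarrow>
        F z I = (\<Sum>\<alpha> | a I \<alpha> \<noteq> (\<lambda>_. 0). a I \<alpha> z * (\<Prod>j\<in>UNIV. nu g j z ^ \<alpha> j)))"

definition ct ::
    "real ^ 'n ^ 'n \<Rightarrow> (complex ^ 'n) set \<Rightarrow> nat \<Rightarrow> 'n tensor_fun \<Rightarrow> 'n tensor_fun" where
  "ct g C s F = (\<lambda>z I. (THE a. nu_expansion g C s F a) I (\<lambda>_. 0) z)"

text \<open>
  \<open>(L F)\<^sub>I\<^sub>,\<^sub>b = 1/2 \<Sum>\<^sub>j g\<^sub>b\<^sub>j \<partial>F\<^sub>I/\<partial>\<nu>\<^sub>j\<close> on coefficients. Only used on nonempty index lists.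
\<close>

definition lowering :: "real ^ 'n ^ 'n \<Rightarrow> 'n nu_poly \<Rightarrow> 'n nu_poly" where
  "lowering g a = (\<lambda>I \<alpha> z. 1/2 * (\<Sum>j\<in>UNIV. of_real (g $ last I $ j) *
     (of_nat (Suc (\<alpha> j)) * a (butlast I) (\<alpha>(j := Suc (\<alpha> j))) z)))"

text \<open>
  The columns of \<open>P\<close> are \<open>e'\<close>, \<open>f'\<close> and a basis of \<open>{e', f'}\<^sup>\<bottom>\<close> over \<open>\<rat>\<close> with Gram matrix \<open>g'\<close>,
  where \<open>e' \<in> M\<close> is primitive and \<open>f' \<in> M\<^sub>\<rat>\<close>, both isotropic with \<open>\<langle>e', f'\<rangle> = 1\<close>.
\<close>

definition cusp_frame ::
    "int ^ 'n ^ 'n \<Rightarrow> real ^ 'n hyp ^ 'n hyp \<Rightarrow> real ^ 'n ^ 'n \<Rightarrow> bool" where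
  "cusp_frame G P g' \<longleftrightarrow>
     invertible P \<and> (\<forall>a b. P $ a $ b \<in> \<rat>) \<and>
     (\<exists>v :: int ^ 'n hyp. column HE P = (\<chi> a. of_int (v $ a)) \<and> Gcd (range (\<lambda>a. v $ a)) = 1) \<and>
     transpose P ** hyp_gram (rmat G) ** P = hyp_gram g'"

text \<open>
  The functionals \<open>\<alpha>\<close> are written as \<open>z \<mapsto> \<langle>\<alpha>, z\<rangle>\<close> with \<open>\<alpha> \<in> \<real>\<^sup>n\<close>; the component of the positive
  cone belonging to the tube domain \<open>C\<close> is the set of imaginary parts of points of \<open>C\<close>.
\<close>

definition cusp_fourier ::
    "real ^ 'n ^ 'n \<Rightarrow> (complex ^ 'n) set \<Rightarrow> (complex ^ 'n \<Rightarrow> complex) \<Rightarrow> bool" where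
  "cusp_fourier g C h \<longleftrightarrow> (\<exists>c :: real ^ 'n \<Rightarrow> complex. \<forall>z\<in>C.
     ((\<lambda>\<alpha>. c \<alpha> * exp (2 * of_real pi * \<i> * bilin (cmat g) (\<chi> i. of_real (\<alpha> $ i)) z))
        has_sum h z) (closure (im_vec ` C)))"

text \<open>
  A modular form \<open>F\<close> on \<open>tube (rmat G) D\<close>, viewed as a section over \<open>D\<close> of the bundle
  \<open>\<L>\<^sup>k \<otimes> \<E>\<^sup>\<otimes>\<^sup>s\<close>, has the coordinates \<open>slash g' P k s F\<close> on the tube domain of the frame \<open>P\<close>.
\<close>

definition cusp_condition ::
    "int ^ 'n ^ 'n \<Rightarrow> (complex ^ 'n hyp) set \<Rightarrow> int \<Rightarrow> nat \<Rightarrow> 'n tensor_fun \<Rightarrow> bool" where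
  "cusp_condition G D k s F \<longleftrightarrow> (\<forall>P g'. cusp_frame G P g' \<longrightarrow>
     (let C' = tube g' {Z. cmat P *v Z \<in> D} in
       \<exists>a. nu_expansion g' C' s (slash g' P k s F) a \<and>
         (\<forall>d I. length I = s + d \<longrightarrow>
            cusp_fourier g' C' (((lowering g' ^^ d) a) I (\<lambda>_. 0)))))"

definition AHMod ::
    "int ^ 'n ^ 'n \<Rightarrow> (complex ^ 'n hyp) set \<Rightarrow> (int ^ 'n hyp ^ 'n hyp) set \<Rightarrow> int \<Rightarrow> nat
      \<Rightarrow> 'n tensor_fun set" where
  "AHMod G D \<Gamma> k s = (let g = rmat G; C = tube g D in
     {F. supported C s F \<and>
         (\<forall>I. smooth_fun_on (\<lambda>z. F z I) C) \<and>
         (\<forall>\<gamma>\<in>\<Gamma>. \<forall>z\<in>C. \<forall>I. length I = s \<longrightarrow> slash g (rmat \<gamma>) k s F z I = F z I) \<and>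
         (\<exists>a. nu_expansion g C s F a) \<and>
         (CARD('n) \<le> 2 \<longrightarrow> cusp_condition G D k s F)})"

definition QMod ::
    "int ^ 'n ^ 'n \<Rightarrow> (complex ^ 'n hyp) set \<Rightarrow> (int ^ 'n hyp ^ 'n hyp) set \<Rightarrow> int \<Rightarrow> nat
      \<Rightarrow> 'n tensor_fun set" where
  "QMod G D \<Gamma> k s = (let g = rmat G; C = tube g D in
     {f. supported C s f \<and> (\<forall>I. holo_on (\<lambda>z. f z I) C) \<and>
         (\<exists>F\<in>AHMod G D \<Gamma> k s. f = ct g C s F)})"

definition scale_tf :: "complex \<Rightarrow> 'n tensor_fun \<Rightarrow> 'n tensor_fun" where
  "scale_tf c F = (\<lambda>z I. c * F z I)"

definition linear_iso_between ::
    "('n tensor_fun \<Rightarrow> 'n tensor_fun) \<Rightarrow> 'n tensor_fun set \<Rightarrow> 'n tensor_fun set \<Rightarrow> bool" where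
  "linear_iso_between T V W \<longleftrightarrow>
     module.subspace scale_tf V \<and> module.subspace scale_tf W \<and>
     (\<forall>F\<in>V. \<forall>F'\<in>V. T (F + F') = T F + T F') \<and>
     (\<forall>c. \<forall>F\<in>V. T (scale_tf c F) = scale_tf c (T F)) \<and>
     bij_betw T V W"

end

theory Submission
  imports Defs "HOL-Complex_Analysis.Conformal_Mappings"
begin

text \<open>
  Only the injectivity of \<open>ct\<close> needs an idea. Write \<open>n(z) = - \<i> y / \<langle>y, y\<rangle>\<close> with \<open>y = Im z\<close>, so that
  \<open>\<nu> = g n\<close> and \<open>F(z) = P(z, n(z))\<close> with \<open>P\<close> holomorphic in \<open>z\<close> and polynomial in the second
  variable. Such a relation determines \<open>P\<close>: fix \<open>y\<close> and continue analytically from the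
  horizontal slice \<open>Im z = y\<close>. Since \<open>\<nu>(\<gamma>z)\<close> is a linear function of \<open>\<nu>(z) - d log J(\<gamma>, z)\<close>, the
  modularity of \<open>F\<close> becomes an identity of polynomials, and its value at \<open>\<nu> = d log J(\<gamma>, z)\<close> shows
  that \<open>P(z, \<cdot>)\<close> vanishes there if the constant term of \<open>F\<close> does. For the Eichler transvections
  \<open>e \<mapsto> e + u - \<langle>u, u\<rangle>/2 f\<close> the factor is \<open>J = 1 - \<langle>z, u\<rangle> + \<langle>u, u\<rangle>\<langle>z, z\<rangle>/4\<close>. On each line \<open>\<int>u\<close>
  infinitely many of them lie in \<open>\<Gamma>\<close>, so the vanishing extends polynomially to all complex \<open>u\<close>.
  Finally \<open>u \<mapsto> g\<^sup>-\<^sup>1 d log J\<close> is a composition of inversions and a translation, hence has dense image,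
  and \<open>P(z, \<cdot>) = 0\<close>.
\<close>

section \<open>Bilinear forms and Eichler transvections\<close>

lemma sum_UNIV_hyp:
  fixes f :: "'n::finite hyp \<Rightarrow> 'a::comm_monoid_add"
  shows "(\<Sum>a\<in>UNIV. f a) = f HE + f HF + (\<Sum>i\<in>UNIV. f (Lat i))"
proof -
  have "inj (Lat :: 'n \<Rightarrow> _)" by (simp add: inj_on_def)
  then have "(\<Sum>a\<in>range Lat. f a) = (\<Sum>i\<in>UNIV. f (Lat i))"
    by (simp add: sum.reindex)
  then show ?thesis
    unfolding UNIV_hyp by (subst sum.union_disjoint) auto
qed

lemma forall_hyp: "(\<forall>a. P a) \<longleftrightarrow> P HE \<and> P HF \<and> (\<forall>i. P (Lat i))"
  by (metis hyp.exhaust)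

lemma bilin_matrix: "bilin g x y = (\<Sum>i\<in>UNIV. x $ i * (g *v y) $ i)"
  by (simp add: bilin_def matrix_vector_mult_def sum_distrib_left mult_ac)

lemma bilin_add_left: "bilin g (x + x') y = bilin g x y + bilin g x' y"
  by (simp add: bilin_matrix sum.distrib algebra_simps)

lemma bilin_add_right: "bilin g x (y + y') = bilin g x y + bilin g x y'"
  by (simp add: bilin_def sum.distrib algebra_simps)

lemma bilin_scale_left: "bilin g (c *s x) y = c * bilin g x y"
  by (simp add: bilin_def sum_distrib_left mult_ac)

lemma bilin_scale_right: "bilin g x (c *s y) = c * bilin g x y"
  by (simp add: bilin_def sum_distrib_left mult_ac)

lemma bilin_diff_left: "bilin g (x - x') y = bilin g x y - bilin g x' y"
  by (simp add: bilin_def sum_subtractf algebra_simps)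

lemma bilin_diff_right: "bilin g x (y - y') = bilin g x y - bilin g x y'"
  by (simp add: bilin_def sum_subtractf algebra_simps)

lemma bilin_minus_left: "bilin g (- x) y = - bilin g x y"
  by (simp add: bilin_def sum_negf)

lemma bilin_minus_right: "bilin g x (- y) = - bilin g x y"
  by (simp add: bilin_def sum_negf)

lemmas bilin_simps = bilin_add_left bilin_add_right bilin_diff_left bilin_diff_right
  bilin_minus_left bilin_minus_right bilin_scale_left bilin_scale_right

lemma bilin_commute: "transpose g = g \<Longrightarrow> bilin g x y = bilin g y x"
  unfolding bilin_def
  apply (subst sum.swap)
  apply (rule sum.cong[OF refl])+
  by (metis (no_types, lifting) mult.assoc mult.commute transpose_def vec_lambda_beta)

lemma bilin_axis_axis: "bilin g (axis i 1) (axis j 1) = g $ i $ j"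
  by (simp add: bilin_def axis_def if_distrib[where f="(*) _"] cong: if_cong)

lemma bilin_axis_left: "bilin g (axis j t) y = t * (g *v y) $ j"
  by (simp add: bilin_matrix axis_def if_distrib[where f="\<lambda>x. x * _"] cong: if_cong)

definition lat :: "'a ^ 'n hyp \<Rightarrow> 'a ^ 'n" where
  "lat x = (\<chi> i. x $ Lat i)"

lemma lat_nth [simp]: "lat x $ i = x $ Lat i"
  by (simp add: lat_def)

lemma bilin_hyp:
  fixes g :: "'a::comm_ring_1 ^ 'n::finite ^ 'n"
  shows "bilin (hyp_gram g) x y = x $ HE * y $ HF + x $ HF * y $ HE + bilin g (lat x) (lat y)"
  by (simp add: bilin_def hyp_gram_def sum_UNIV_hyp)

text \<open>Matrix of \<open>e \<mapsto> e + u - h f\<close>, \<open>f \<mapsto> f\<close>, \<open>l \<mapsto> l - \<langle>l, u\<rangle> f\<close>; an isometry if \<open>2 h = \<langle>u, u\<rangle>\<close>.\<close>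

definition eichler :: "'a::comm_ring_1 ^ 'n ^ 'n \<Rightarrow> 'a ^ 'n \<Rightarrow> 'a \<Rightarrow> 'a ^ 'n hyp ^ 'n hyp" where
  "eichler g u h = (\<chi> a b. case (a, b) of
      (HE, HE) \<Rightarrow> 1 | (HF, HF) \<Rightarrow> 1
    | (HF, HE) \<Rightarrow> - h
    | (HF, Lat i) \<Rightarrow> - (g *v u) $ i
    | (Lat i, HE) \<Rightarrow> u $ i
    | (Lat i, Lat j) \<Rightarrow> if i = j then 1 else 0
    | _ \<Rightarrow> 0)"

lemma eichler_mult:
  fixes g :: "'a::comm_ring_1 ^ 'n::finite ^ 'n"
  shows "(eichler g u h *v x) $ HE = x $ HE"
    and "(eichler g u h *v x) $ HF = x $ HF - h * x $ HE - bilin g (lat x) u"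
    and "(eichler g u h *v x) $ Lat i = x $ Lat i + x $ HE * u $ i"
  by (simp_all add: eichler_def matrix_vector_mult_def sum_UNIV_hyp bilin_matrix sum_negf
      if_distrib[where f="\<lambda>x. x * _"] if_distrib[where f="(*) _"] mult.commute cong: if_cong)

lemma lat_eichler: "lat (eichler g u h *v x) = lat x + (x $ HE) *s u"
  for g :: "'a::comm_ring_1 ^ 'n::finite ^ 'n"
  by (simp add: vec_eq_iff eichler_mult)

lemma eichler_isometry:
  fixes g :: "'a::comm_ring_1 ^ 'n::finite ^ 'n"
  assumes "transpose g = g" "2 * h = bilin g u u"
  shows "bilin (hyp_gram g) (eichler g u h *v x) (eichler g u h *v y) = bilin (hyp_gram g) x y"
proof -
  have "bilin (hyp_gram g) (eichler g u h *v x) (eichler g u h *v y) - bilin (hyp_gram g) x y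
      = x $ HE * y $ HE * (bilin g u u - 2 * h)"
    using bilin_commute[OF assms(1), of u "lat y"]
    by (simp add: bilin_hyp eichler_mult lat_eichler bilin_simps algebra_simps)
  then show ?thesis using assms(2) by simp
qed

text \<open>The right factor acts first and adds \<open>v\<close> to the image of \<open>e\<close>;
  the left factor sends this \<open>v\<close> to \<open>v - \<langle>v, u\<rangle> f\<close>, which
  is the cross term. If \<open>h\<close> and \<open>k\<close> are half norms and the form is
  symmetric, the new parameter is half the norm of \<open>u + v\<close>, so transvections compose as
  vectors add.\<close>

lemma eichler_add:
  fixes g :: "'a::comm_ring_1 ^ 'n::finite ^ 'n"
  shows "eichler g u h ** eichler g v k = eichler g (u + v) (h + k + bilin g v u)"
  unfolding matrix_eq matrix_vector_mul_assoc[symmetric]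
  by (auto simp: vec_eq_iff forall_hyp eichler_mult lat_eichler bilin_simps algebra_simps)

lemma eichler_0: "eichler g 0 0 = (mat 1 :: 'a::comm_ring_1 ^ 'n::finite hyp ^ 'n hyp)"
  by (auto simp: vec_eq_iff forall_hyp eichler_def mat_def)

text \<open>Passes from vectors to the matrix equation that \<open>Oplus\<close> asks for: matrix
  entries are the values of the form on pairs of basis vectors.\<close>

lemma isometry_matrix_eq:
  fixes S A :: "'a::comm_ring_1 ^ 'm::finite ^ 'm"
  assumes "\<And>x y. bilin S (A *v x) (A *v y) = bilin S x y"
  shows "transpose A ** S ** A = S"
proof -
  have "bilin (transpose A ** S ** A) x y = bilin S x y" for x y
  proof -
    have "(\<Sum>i\<in>UNIV. x $ i * (transpose A *v w) $ i) = (\<Sum>i\<in>UNIV. (A *v x) $ i * w $ i)" for w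
      unfolding matrix_vector_mult_def transpose_def vec_lambda_beta sum_distrib_left sum_distrib_right
      by (subst sum.swap) (simp add: mult_ac)
    then have "bilin (transpose A ** S ** A) x y = bilin S (A *v x) (A *v y)"
      by (simp add: bilin_matrix matrix_vector_mul_assoc[symmetric] del: matrix_transpose_mul)
    then show ?thesis using assms by simp
  qed
  then show ?thesis by (metis bilin_axis_axis vec_eq_iff)
qed

section \<open>Algebraic independence of the \<open>\<nu>\<^sub>j\<close> over the holomorphic functions\<close>

lemma poly_fun_const: "(\<lambda>t. c) \<in> range (poly :: 'a::comm_ring_1 poly \<Rightarrow> _)"
  by (rule range_eqI[of _ _ "[:c:]"]) auto

lemma poly_fun_id: "(\<lambda>t. t) \<in> range (poly :: 'a::comm_ring_1 poly \<Rightarrow> _)"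
  by (rule range_eqI[of _ _ "[:0, 1:]"]) auto

lemma poly_fun_add:
  "f \<in> range poly \<Longrightarrow> h \<in> range poly \<Longrightarrow> (\<lambda>t. f t + h t :: 'a::comm_ring_1) \<in> range poly"
proof -
  assume "f \<in> range poly" "h \<in> range poly"
  then obtain p r where "f = poly p" "h = poly r" by blast
  then have "(\<lambda>t. f t + h t) = poly (p + r)" by auto
  then show ?thesis by blast
qed

lemma poly_fun_mult:
  "f \<in> range poly \<Longrightarrow> h \<in> range poly \<Longrightarrow> (\<lambda>t. f t * h t :: 'a::comm_ring_1) \<in> range poly"
proof -
  assume "f \<in> range poly" "h \<in> range poly"
  then obtain p r where "f = poly p" "h = poly r" by blast
  then have "(\<lambda>t. f t * h t) = poly (p * r)" by auto
  then show ?thesis by blast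
qed

lemma poly_fun_minus: "f \<in> range poly \<Longrightarrow> (\<lambda>t. - f t :: 'a::comm_ring_1) \<in> range poly"
  using poly_fun_mult[OF poly_fun_const[of "-1"], of f] by simp

lemma poly_fun_diff:
  "f \<in> range poly \<Longrightarrow> h \<in> range poly \<Longrightarrow> (\<lambda>t. f t - h t :: 'a::comm_ring_1) \<in> range poly"
  using poly_fun_add[of f "\<lambda>t. - h t"] poly_fun_minus[of h] by simp

lemma poly_fun_sum:
  "(\<And>i. i \<in> A \<Longrightarrow> f i \<in> range poly) \<Longrightarrow> (\<lambda>t. \<Sum>i\<in>A. f i t :: 'a::comm_ring_1) \<in> range poly"
  by (induction A rule: infinite_finite_induct) (auto intro: poly_fun_const poly_fun_add)

lemma poly_fun_prod:
  "(\<And>i. i \<in> A \<Longrightarrow> f i \<in> range poly) \<Longrightarrow> (\<lambda>t. \<Prod>i\<in>A. f i t :: 'a::comm_ring_1) \<in> range poly"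
  by (induction A rule: infinite_finite_induct) (auto intro: poly_fun_const poly_fun_mult)

lemma poly_fun_power: "f \<in> range poly \<Longrightarrow> (\<lambda>t. f t ^ m :: 'a::comm_ring_1) \<in> range poly"
  by (induction m) (auto intro: poly_fun_const poly_fun_mult)

lemmas poly_fun_intros = poly_fun_const poly_fun_id poly_fun_add poly_fun_mult poly_fun_minus
  poly_fun_diff poly_fun_sum poly_fun_prod poly_fun_power

lemma poly_fun_zero:
  fixes f :: "'a::idom \<Rightarrow> 'a"
  assumes "f \<in> range poly" "infinite {t. f t = 0}"
  shows "f t = 0"
proof -
  obtain p where p: "f = poly p" using assms(1) by auto
  then have "p = 0" using assms(2) poly_roots_finite[of p] by auto
  then show ?thesis by (simp add: p)
qed

text \<open>Polynomiality is tested only on complex lines. This is closed under ring operations and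
  is exactly what allows infinitely many zeros on a line to spread to the whole line.\<close>

definition line_poly :: "(complex ^ 'n \<Rightarrow> complex) \<Rightarrow> bool" where
  "line_poly f \<longleftrightarrow> (\<forall>a b. (\<lambda>t. f (a + t *s b)) \<in> range poly)"

lemma line_polyD: "line_poly f \<Longrightarrow> (\<lambda>t. f (a + t *s b)) \<in> range poly"
  by (simp add: line_poly_def)

lemma line_poly_zero:
  assumes "line_poly f" "infinite {t. f (a + t *s b) = 0}"
  shows "f (a + t *s b) = 0"
  using poly_fun_zero[OF line_polyD[OF assms(1)] assms(2)] .

lemma line_poly_nth: "line_poly (\<lambda>v. v $ j)"
  unfolding line_poly_def by (simp add: poly_fun_intros)

lemma line_poly_add: "line_poly f \<Longrightarrow> line_poly h \<Longrightarrow> line_poly (\<lambda>v. f v + h v)"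
  unfolding line_poly_def by (simp add: poly_fun_intros)

lemma line_poly_diff: "line_poly f \<Longrightarrow> line_poly h \<Longrightarrow> line_poly (\<lambda>v. f v - h v)"
  unfolding line_poly_def by (simp add: poly_fun_intros)

lemma line_poly_const: "line_poly (\<lambda>v. c)"
  unfolding line_poly_def by (simp add: poly_fun_intros)

lemma line_poly_mult: "line_poly f \<Longrightarrow> line_poly h \<Longrightarrow> line_poly (\<lambda>v. f v * h v)"
  unfolding line_poly_def by (simp add: poly_fun_intros)

lemma line_poly_power: "line_poly f \<Longrightarrow> line_poly (\<lambda>v. f v ^ m)"
  unfolding line_poly_def by (simp add: poly_fun_intros)

lemma line_poly_sum: "(\<And>i. i \<in> A \<Longrightarrow> line_poly (f i)) \<Longrightarrow> line_poly (\<lambda>v. \<Sum>i\<in>A. f i v)"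
  unfolding line_poly_def by (simp add: poly_fun_intros)

lemma line_poly_prod: "(\<And>i. i \<in> A \<Longrightarrow> line_poly (f i)) \<Longrightarrow> line_poly (\<lambda>v. \<Prod>i\<in>A. f i v)"
  unfolding line_poly_def by (simp add: poly_fun_intros)

lemmas line_poly_intros = line_poly_nth line_poly_add line_poly_diff line_poly_const
  line_poly_mult line_poly_power line_poly_sum line_poly_prod

text \<open>On the line from \<open>x0\<close> to \<open>x\<close> the factor \<open>h\<close> has
  finitely many zeros, since it is nonzero at \<open>x0\<close>. So \<open>f\<close> vanishes at
  infinitely many points of this line, hence at \<open>x\<close>.\<close>

lemma line_poly_cancel:
  assumes f: "line_poly f" and h: "line_poly h" and "h x0 \<noteq> 0" and fh: "\<And>x. f x * h x = 0"
  shows "f x = 0"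
proof -
  obtain p where p: "\<And>t. h (x0 + t *s (x - x0)) = poly p t"
    using line_polyD[OF h] by (metis imageE)
  have "p \<noteq> 0" using p[of 0] \<open>h x0 \<noteq> 0\<close> by auto
  then have "finite {t. poly p t = 0}" by (rule poly_roots_finite)
  moreover have "UNIV - {t. poly p t = 0} \<subseteq> {t. f (x0 + t *s (x - x0)) = 0}"
  proof
    fix t assume "t \<in> UNIV - {t. poly p t = 0}"
    then show "t \<in> {t. f (x0 + t *s (x - x0)) = 0}"
      using fh[of "x0 + t *s (x - x0)"] p[of t] by simp
  qed
  ultimately have "infinite {t. f (x0 + t *s (x - x0)) = 0}"
    using Diff_infinite_finite[OF _ infinite_UNIV_char_0] finite_subset by blast
  from line_poly_zero[OF f this, of 1] show ?thesis by simp
qed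

text \<open>Induction on the set \<open>X\<close> of variables in play. The injectivity hypothesis
  keeps the monomials distinct after restriction to \<open>X\<close>; with no variable left it
  forces \<open>A\<close> to be a singleton.\<close>

lemma monomial_sum_zero_partial:
  fixes p :: "('n \<Rightarrow> nat) \<Rightarrow> complex"
  assumes "finite X" "finite A" "inj_on (\<lambda>\<alpha>. restrict \<alpha> X) A"
    and "\<And>v. (\<Sum>\<alpha>\<in>A. p \<alpha> * (\<Prod>j\<in>X. v j ^ \<alpha> j)) = 0" "\<alpha> \<in> A"
  shows "p \<alpha> = 0"
  using assms
proof (induction X arbitrary: A \<alpha> p rule: finite_induct)
  case empty
  then have "A = {\<alpha>}" by (auto simp: inj_on_def)
  then show ?case using empty.prems(3) by simp
next
  case (insert j X)
  \<comment> \<open>A bound for the exponents of \<open>j\<close>, so that grouping the sum by this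
    exponent gives one polynomial in the value \<open>x\<close> of that variable, whose coefficients
    must vanish.\<close>
  define K where "K = Max ((\<lambda>\<alpha>. \<alpha> j) ` A)"
  have K: "\<beta> j \<le> K" if "\<beta> \<in> A" for \<beta>
    unfolding K_def using insert.prems(1) that by (intro Max_ge) auto
  have sum: "(\<Sum>\<beta>\<in>{\<beta>\<in>A. \<beta> j = \<alpha> j}. p \<beta> * (\<Prod>l\<in>X. v l ^ \<beta> l)) = 0" for v
  proof -
    have "(\<Sum>m\<le>K. (\<Sum>\<beta>\<in>{\<beta>\<in>A. \<beta> j = m}. p \<beta> * (\<Prod>l\<in>X. v l ^ \<beta> l)) * x ^ m) = 0" for x
    proof -
      have "(\<Prod>l\<in>X. (v(j := x)) l ^ \<beta> l) = (\<Prod>l\<in>X. v l ^ \<beta> l)" for \<beta>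
        using insert.hyps(2) by (intro prod.cong) auto
      then have "0 = (\<Sum>\<beta>\<in>A. p \<beta> * (\<Prod>l\<in>X. v l ^ \<beta> l) * x ^ \<beta> j)"
        using insert.prems(3)[of "v(j := x)"] insert.hyps by (simp add: mult_ac)
      also have "\<dots> = (\<Sum>m\<le>K. \<Sum>\<beta>\<in>{\<beta>\<in>A. \<beta> j = m}. p \<beta> * (\<Prod>l\<in>X. v l ^ \<beta> l) * x ^ \<beta> j)"
        using insert.prems(1) K by (intro sum.group[symmetric]) auto
      finally show ?thesis by (simp add: sum_distrib_right)
    qed
    then have "\<forall>m\<le>K. (\<Sum>\<beta>\<in>{\<beta>\<in>A. \<beta> j = m}. p \<beta> * (\<Prod>l\<in>X. v l ^ \<beta> l)) = 0"
      using polyfun_eq_0[of "\<lambda>m. \<Sum>\<beta>\<in>{\<beta>\<in>A. \<beta> j = m}. p \<beta> * (\<Prod>l\<in>X. v l ^ \<beta> l)" K] by simp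
    then show ?thesis using K[OF insert.prems(4)] by blast
  qed
  have inj: "inj_on (\<lambda>\<beta>. restrict \<beta> X) {\<beta>\<in>A. \<beta> j = \<alpha> j}"
  proof (rule inj_onI)
    fix \<beta> \<gamma> assume b: "\<beta> \<in> {\<beta>\<in>A. \<beta> j = \<alpha> j}" "\<gamma> \<in> {\<beta>\<in>A. \<beta> j = \<alpha> j}"
      and eq: "restrict \<beta> X = restrict \<gamma> X"
    have "restrict \<beta> (insert j X) = restrict \<gamma> (insert j X)"
    proof
      fix x show "restrict \<beta> (insert j X) x = restrict \<gamma> (insert j X) x"
        using b fun_cong[OF eq, of x] by (auto simp: restrict_def)
    qed
    then show "\<beta> = \<gamma>" by (rule inj_onD[OF insert.prems(2)]) (use b in auto)
  qed
  show ?case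
    by (rule insert.IH[OF _ inj sum]) (use insert.prems(1,4) in auto)
qed

lemma monomial_sum_zero:
  fixes p :: "('n::finite \<Rightarrow> nat) \<Rightarrow> complex"
  assumes "finite A" "\<And>v :: complex ^ 'n. (\<Sum>\<alpha>\<in>A. p \<alpha> * (\<Prod>j\<in>UNIV. v $ j ^ \<alpha> j)) = 0" "\<alpha> \<in> A"
  shows "p \<alpha> = 0"
proof (rule monomial_sum_zero_partial[of UNIV A])
  show "(\<Sum>\<alpha>\<in>A. p \<alpha> * (\<Prod>j\<in>UNIV. v j ^ \<alpha> j)) = 0" for v
    using assms(2)[of "\<chi> j. v j"] by simp
qed (use assms in \<open>auto simp: inj_on_def restrict_def\<close>)

text \<open>\<open>N\<close> only has to dominate the total degree of every monomial; the sum of all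
  these degrees does.\<close>

lemma clear_denominators:
  fixes p :: "('n::finite \<Rightarrow> nat) \<Rightarrow> complex"
  assumes "finite A" "\<And>j. c j \<in> range poly" "d \<in> range poly"
  shows "\<exists>N. \<exists>r\<in>range poly. \<forall>t. d t \<noteq> 0 \<longrightarrow>
    d t ^ N * (\<Sum>\<alpha>\<in>A. p \<alpha> * (\<Prod>j\<in>UNIV. (c j t / d t) ^ \<alpha> j)) = r t"
proof -
  define deg :: "('n \<Rightarrow> nat) \<Rightarrow> nat" where "deg \<alpha> = (\<Sum>j\<in>UNIV. \<alpha> j)" for \<alpha>
  define N where "N = (\<Sum>\<alpha>\<in>A. deg \<alpha>)"
  define r where "r t = (\<Sum>\<alpha>\<in>A. p \<alpha> * (\<Prod>j\<in>UNIV. c j t ^ \<alpha> j) * d t ^ (N - deg \<alpha>))" for t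
  have "r \<in> range poly"
    unfolding r_def by (intro poly_fun_intros assms)
  moreover have "d t ^ N * (\<Sum>\<alpha>\<in>A. p \<alpha> * (\<Prod>j\<in>UNIV. (c j t / d t) ^ \<alpha> j)) = r t"
    if "d t \<noteq> 0" for t
    unfolding r_def sum_distrib_left
  proof (rule sum.cong[OF refl])
    fix \<alpha> assume "\<alpha> \<in> A"
    then have "deg \<alpha> \<le> N" unfolding N_def using assms(1) by (simp add: member_le_sum)
    then have "d t ^ N = d t ^ deg \<alpha> * d t ^ (N - deg \<alpha>)"
      by (simp flip: power_add)
    moreover have "(\<Prod>j\<in>UNIV. (c j t / d t) ^ \<alpha> j) = (\<Prod>j\<in>UNIV. c j t ^ \<alpha> j) / d t ^ deg \<alpha>"
      by (simp add: power_divide prod_dividef deg_def power_sum)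
    ultimately show "d t ^ N * (p \<alpha> * (\<Prod>j\<in>UNIV. (c j t / d t) ^ \<alpha> j))
        = p \<alpha> * (\<Prod>j\<in>UNIV. c j t ^ \<alpha> j) * d t ^ (N - deg \<alpha>)"
      using that by (simp add: field_simps)
  qed
  ultimately show ?thesis by blast
qed

section \<open>The vector \<open>n(z)\<close> and polynomial relations satisfied by it\<close>

definition cvec :: "real ^ 'n \<Rightarrow> complex ^ 'n" where
  "cvec y = (\<chi> i. of_real (y $ i))"

definition nvec :: "real ^ 'n ^ 'n \<Rightarrow> complex ^ 'n \<Rightarrow> complex ^ 'n" where
  "nvec g z = (- \<i> / of_real (bilin g (im_vec z) (im_vec z))) *s cvec (im_vec z)"

lemma continuous_on_bilin [continuous_intros]:
  fixes g :: "'a::real_normed_field ^ 'n::finite ^ 'n"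
  assumes "continuous_on S f" "continuous_on S h"
  shows "continuous_on S (\<lambda>x. bilin g (f x) (h x))"
  unfolding bilin_def by (intro continuous_intros assms)

lemma norm_cvec: "norm (cvec y) = norm y"
  by (simp add: norm_vec_def cvec_def)

text \<open>\<open>nvec g z\<close> depends only on \<open>Im z\<close>. Freezing its value on a
  slice leaves a function holomorphic in \<open>z\<close>, which continues from the slice back to
  \<open>z0\<close>. Thus \<open>Q z0\<close> vanishes at the values of \<open>nvec\<close> for all
  nearby imaginary parts, and these are enough to kill a polynomial.\<close>

lemma nvec_polynomial_relation:
  fixes Q :: "complex ^ 'n::finite \<Rightarrow> complex ^ 'n \<Rightarrow> complex"
  assumes C: "open C" "z0 \<in> C" and pos: "bilin g (im_vec z0) (im_vec z0) > 0"
    and hol: "\<And>v a b S. open S \<Longrightarrow> (\<And>s. s \<in> S \<Longrightarrow> a + s *s b \<in> C) \<Longrightarrow>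
      (\<lambda>s. Q (a + s *s b) v) holomorphic_on S"
    and pol: "line_poly (Q z0)"
    and zero: "\<And>z. z \<in> C \<Longrightarrow> Q z (nvec g z) = 0"
  shows "Q z0 v = 0"
proof -
  define q where "q y = bilin g y y" for y
  define y0 where "y0 = im_vec z0"
  obtain \<delta> where \<delta>: "\<delta> > 0" "ball z0 \<delta> \<subseteq> C"
    using C by (meson open_contains_ball)
  \<comment> \<open>With \<open>b\<close> below \<open>\<delta> / 2\<close>, the points
    \<open>z0 + s b\<close> stay in the ball for all \<open>s\<close> in the disc of radius 2, which
    contains both 0 and part of the line \<open>Im s = 1\<close>.\<close>
  have *: "Q z0 ((- \<i> / of_real (q (y0 + b))) *s cvec (y0 + b)) = 0" if b: "norm b < \<delta> / 2" for b
  proof -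
    define v1 where "v1 = (- \<i> / of_real (q (y0 + b))) *s cvec (y0 + b)"
    \<comment> \<open>On the line \<open>Im s = 1\<close> the imaginary part is constantly \<open>y0 + b\<close>, so \<open>f\<close> vanishes there.\<close>
    define f where "f s = Q (z0 + s *s cvec b) v1" for s
    define U where "U = {s \<in> ball 0 2. Im s = 1}"
    have norm_smult: "norm (s *s w) = norm s * norm w" for s and w :: "complex ^ 'n"
      by (simp add: norm_vec_def L2_set_right_distrib norm_mult)
    have inC: "z0 + s *s cvec b \<in> C" if "s \<in> ball 0 2" for s
    proof -
      have "norm (s *s cvec b) \<le> 2 * norm b"
        using that by (simp add: norm_smult norm_cvec mult_right_mono)
      then have "z0 + s *s cvec b \<in> ball z0 \<delta>" using b by (simp add: dist_norm)
      then show ?thesis using \<delta>(2) by blast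
    qed
    have "f holomorphic_on ball 0 2"
      unfolding f_def by (rule hol) (use inC in auto)
    moreover have "f s = 0" if "s \<in> U" for s
    proof -
      have "im_vec (z0 + s *s cvec b) = y0 + b"
        using that by (simp add: U_def y0_def im_vec_def cvec_def vec_eq_iff)
      then have "nvec g (z0 + s *s cvec b) = v1"
        by (simp add: nvec_def v1_def q_def)
      then show ?thesis using zero[OF inC, of s] that by (simp add: f_def U_def)
    qed
    moreover have "\<i> islimpt U"
      unfolding islimpt_approachable
    proof (intro allI impI)
      fix e :: real assume e: "e > 0"
      define x where "x = min (e / 2) (1 / 2)"
      have x: "0 < x" "x < e" "x \<le> 1 / 2" using e by (auto simp: x_def min_def)
      have "norm (\<i> + of_real x) \<le> 1 + x"
        using norm_triangle_ineq[of \<i> "of_real x"] x by simp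
      then have "\<i> + of_real x \<in> U" using x by (simp add: U_def)
      then show "\<exists>x'\<in>U. x' \<noteq> \<i> \<and> dist x' \<i> < e"
        using x by (intro bexI[of _ "\<i> + of_real x"]) (auto simp: dist_norm)
    qed
    ultimately have "f 0 = 0"
      by (intro analytic_continuation[of f "ball 0 2" U \<i> 0]) (auto simp: U_def)
    then show ?thesis by (simp add: f_def v1_def)
  qed
  \<comment> \<open>Up to the factor \<open>- \<i>\<close>, \<open>nvec\<close> is the inversion
    \<open>y \<mapsto> y / q y\<close>, which is its own inverse. Its values near \<open>y0\<close>
    therefore fill a neighbourhood of \<open>v0\<close>.\<close>
  define v0 where "v0 = (1 / q y0) *\<^sub>R y0"
  have q_scale: "q (c *\<^sub>R y) = c\<^sup>2 * q y" for c y
    by (simp add: q_def scalar_mult_eq_scaleR[symmetric] bilin_simps power2_eq_square)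
  have q0: "q y0 > 0" using pos by (simp add: q_def y0_def)
  have qv0: "q v0 = 1 / q y0" using q0 by (simp add: v0_def q_scale power2_eq_square)
  have contq: "isCont q v" for v
    using continuous_on_bilin[of UNIV "\<lambda>x. x" "\<lambda>x. x" g]
    by (simp add: q_def[abs_def] continuous_on_eq_continuous_at)
  have "((\<lambda>v. (1 / q v) *\<^sub>R v) \<longlongrightarrow> (1 / q v0) *\<^sub>R v0) (nhds v0)"
    using contq[of v0] qv0 q0
    by (intro tendsto_intros filterlim_ident) (auto simp: continuous_at tendsto_nhds_iff)
  moreover have "(1 / q v0) *\<^sub>R v0 = y0" using q0 by (simp add: qv0) (simp add: v0_def)
  ultimately have "\<forall>\<^sub>F v in nhds v0. dist ((1 / q v) *\<^sub>R v) y0 < \<delta> / 2"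
    using \<delta>(1) by (auto simp: tendsto_iff dest!: spec[of _ "\<delta> / 2"])
  moreover have "\<forall>\<^sub>F v in nhds v0. q v \<noteq> 0"
    using contq[of v0] qv0 q0
    by (intro tendsto_imp_eventually_ne[of q "q v0"]) (auto simp: continuous_at tendsto_nhds_iff)
  ultimately have ev: "\<forall>\<^sub>F v in nhds v0. Q z0 (- \<i> *s cvec v) = 0"
  proof eventually_elim
    case (elim v)
    define y where "y = (1 / q v) *\<^sub>R v"
    have "q y = 1 / q v" using elim by (simp add: y_def q_scale power2_eq_square)
    then have "(- \<i> / of_real (q y)) *s cvec y = - \<i> *s cvec v"
      using elim(2) by (simp add: y_def vec_eq_iff cvec_def)
    then show ?case using *[of "y - y0"] elim(1) by (simp add: y_def dist_norm)
  qed
  \<comment> \<open>The segment from \<open>v0\<close> towards \<open>x\<close> starts inside that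
    neighbourhood, which gives infinitely many zeros on the line through \<open>x\<close>.\<close>
  have real: "Q z0 (- \<i> *s cvec x) = 0" for x
  proof -
    have "((\<lambda>t. v0 + t *\<^sub>R (x - v0)) \<longlongrightarrow> v0 + 0 *\<^sub>R (x - v0)) (at (0::real))"
      by (intro tendsto_intros)
    then have "\<forall>\<^sub>F t in at 0. Q z0 (- \<i> *s cvec (v0 + t *\<^sub>R (x - v0))) = 0"
      using ev by (auto simp: filterlim_def le_filter_def eventually_filtermap)
    then obtain e where e: "e > 0"
      "\<And>t. t \<noteq> 0 \<Longrightarrow> \<bar>t\<bar> < e \<Longrightarrow> Q z0 (- \<i> *s cvec (v0 + t *\<^sub>R (x - v0))) = 0"
      by (auto simp: eventually_at dist_norm)
    have eq: "- \<i> *s cvec (v0 + t *\<^sub>R (x - v0)) = (- \<i> *s cvec v0) + of_real t *s (- \<i> *s cvec (x - v0))" for t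
      by (simp add: vec_eq_iff cvec_def algebra_simps)
    have "of_real ` {0<..<e} \<subseteq> {t. Q z0 ((- \<i> *s cvec v0) + t *s (- \<i> *s cvec (x - v0))) = 0}"
    proof (rule image_subsetI)
      fix t assume "t \<in> {0<..<e}"
      then have "Q z0 (- \<i> *s cvec (v0 + t *\<^sub>R (x - v0))) = 0" using e(2)[of t] by auto
      then show "of_real t \<in> {t. Q z0 ((- \<i> *s cvec v0) + t *s (- \<i> *s cvec (x - v0))) = 0}"
        unfolding eq by (rule CollectI)
    qed
    moreover have "infinite (of_real ` {0<..<e} :: complex set)"
      using e(1) by (simp add: finite_image_iff inj_on_def)
    ultimately have "infinite {t. Q z0 ((- \<i> *s cvec v0) + t *s (- \<i> *s cvec (x - v0))) = 0}"
      using finite_subset by blast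
    from line_poly_zero[OF pol this, of 1] show ?thesis using eq[of 1] by simp
  qed
  \<comment> \<open>Now \<open>v = - \<i> (c + \<i> d)\<close>: the vanishing at real parameters of
    the line through \<open>c\<close> in direction \<open>d\<close> is extended to the parameter
    \<open>\<i>\<close>.\<close>
  define c where "c = (\<chi> i. - Im (v $ i))"
  define d where "d = (\<chi> i. Re (v $ i))"
  have eq: "(- \<i> *s cvec c) + of_real t *s (- \<i> *s cvec d) = - \<i> *s cvec (c + t *\<^sub>R d)" for t
    by (simp add: vec_eq_iff cvec_def algebra_simps)
  have "range of_real \<subseteq> {t. Q z0 ((- \<i> *s cvec c) + t *s (- \<i> *s cvec d)) = 0}"
    by (intro image_subsetI CollectI) (unfold eq, rule real)
  moreover have "infinite (range of_real :: complex set)"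
    by (simp add: finite_image_iff inj_on_def infinite_UNIV_char_0)
  ultimately have "infinite {t. Q z0 ((- \<i> *s cvec c) + t *s (- \<i> *s cvec d)) = 0}"
    using finite_subset by blast
  from line_poly_zero[OF pol this, of \<i>]
  have "Q z0 ((- \<i> *s cvec c) + \<i> *s (- \<i> *s cvec d)) = 0" .
  moreover have "(- \<i> *s cvec c) + \<i> *s (- \<i> *s cvec d) = v"
    by (simp add: vec_eq_iff cvec_def c_def d_def complex_eq_iff)
  ultimately show ?thesis by simp
qed

section \<open>Expansions in the \<open>\<nu>\<^sub>j\<close> and linearity of the constant term\<close>

lemma Ck_on_cong:
  assumes "open C" "\<And>x. x \<in> C \<Longrightarrow> f x = h x" "Ck_on m f C"
  shows "Ck_on m h C"
  using assms(2,3)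
proof (induction m arbitrary: f h)
  case 0
  then show ?case using continuous_on_cong[of C C f h] by simp
next
  case (Suc m)
  have der: "(h has_derivative frechet_derivative f (at x)) (at x)" if "x \<in> C" for x
    using Suc.prems that frechet_derivative_works
    by (intro has_derivative_transform_within_open[of f _ x UNIV C h]) (auto simp: assms(1))
  have eq: "frechet_derivative f (at x) = frechet_derivative h (at x)" if "x \<in> C" for x
    by (rule frechet_derivative_at[OF der[OF that]])
  have "Ck_on m (\<lambda>x. frechet_derivative h (at x) v) C" for v
  proof (rule Suc.IH)
    show "Ck_on m (\<lambda>x. frechet_derivative f (at x) v) C" using Suc.prems(2) by simp
  qed (simp only: eq)
  then show ?case using der by (auto simp: differentiable_def)
qed

lemma Ck_on_zero: "Ck_on m (\<lambda>x. 0) C"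
  by (induction m) auto

lemma Ck_on_lincomb:
  fixes f h :: "'a::real_normed_vector \<Rightarrow> 'b::real_normed_algebra"
  assumes "open C" "Ck_on m f C" "Ck_on m h C"
  shows "Ck_on m (\<lambda>x. c * f x + h x) C"
  using assms(2,3)
proof (induction m arbitrary: f h)
  case 0
  then show ?case by (auto intro!: continuous_intros)
next
  case (Suc m)
  have der: "((\<lambda>x. c * f x + h x) has_derivative
      (\<lambda>v. c * frechet_derivative f (at x) v + frechet_derivative h (at x) v)) (at x)" if "x \<in> C" for x
    using Suc.prems that frechet_derivative_works
    by (auto intro!: derivative_eq_intros)
  have "Ck_on m (\<lambda>x. frechet_derivative (\<lambda>x. c * f x + h x) (at x) v) C" for v
  proof (rule Ck_on_cong[OF assms(1)])
    show "Ck_on m (\<lambda>x. c * frechet_derivative f (at x) v + frechet_derivative h (at x) v) C"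
      using Suc by auto
    show "c * frechet_derivative f (at x) v + frechet_derivative h (at x) v =
        frechet_derivative (\<lambda>x. c * f x + h x) (at x) v" if "x \<in> C" for x
      using frechet_derivative_at[OF der[OF that]] by metis
  qed
  then show ?case using der by (auto simp: differentiable_def)
qed

lemma holo_on_lincomb:
  assumes "holo_on f C" "holo_on h C"
  shows "holo_on (\<lambda>z. c * f z + h z) C"
  unfolding holo_on_def
proof
  fix z assume "z \<in> C"
  then obtain D E where "(f has_derivative D) (at z within C)" "\<forall>c v. D (c *s v) = c * D v"
    "(h has_derivative E) (at z within C)" "\<forall>c v. E (c *s v) = c * E v"
    using assms unfolding holo_on_def by blast
  then show "\<exists>D. ((\<lambda>z. c * f z + h z) has_derivative D) (at z within C) \<and> (\<forall>c v. D (c *s v) = c * D v)"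
    by (intro exI[of _ "\<lambda>v. c * D v + E v"]) (auto intro!: derivative_eq_intros simp: algebra_simps)
qed

lemma holo_on_zero: "holo_on (\<lambda>_. 0) C"
  unfolding holo_on_def by (auto intro!: exI[of _ "\<lambda>_. 0"] derivative_eq_intros)

lemma bounded_linear_axis: "bounded_linear (axis j :: complex \<Rightarrow> complex ^ 'n::finite)"
proof
  show "\<exists>K. \<forall>x. norm (axis j x :: complex ^ 'n) \<le> norm x * K"
    by (intro exI[of _ 1]) (simp add: norm_vec_def L2_set_def axis_def if_distrib[of norm] if_distrib[of "\<lambda>x. x\<^sup>2"] cong: if_cong)
qed (auto simp: axis_def vec_eq_iff)

text \<open>The component derivatives are assembled into a derivative of \<open>w\<close> through
  axis vectors. Complex linearity of \<open>D\<close> then turns the chain rule for real derivatives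
  into a complex derivative.\<close>

lemma holo_on_compose:
  fixes w :: "complex \<Rightarrow> complex ^ 'n::finite"
  assumes f: "holo_on f C" and w: "\<And>j. (\<lambda>s. w s $ j) holomorphic_on S" and wS: "w ` S \<subseteq> C"
  shows "(\<lambda>s. f (w s)) holomorphic_on S"
  unfolding holomorphic_on_def field_differentiable_def
proof
  fix s assume s: "s \<in> S"
  obtain D where D: "(f has_derivative D) (at (w s) within C)" "\<And>c v. D (c *s v) = c * D v"
    using f s wS unfolding holo_on_def by blast
  obtain w' where w': "\<And>j. ((\<lambda>s. w s $ j) has_field_derivative w' j) (at s within S)"
  proof -
    have "\<forall>j. \<exists>d. ((\<lambda>s. w s $ j) has_field_derivative d) (at s within S)"
      using w s unfolding holomorphic_on_def field_differentiable_def by blast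
    from choice[OF this] show thesis using that by blast
  qed
  have "((\<lambda>s. \<Sum>j\<in>UNIV. axis j (w s $ j)) has_derivative (\<lambda>h. \<Sum>j\<in>UNIV. axis j (w' j * h))) (at s within S)"
    by (intro has_derivative_sum bounded_linear.has_derivative[OF bounded_linear_axis])
      (use w' in \<open>simp add: has_field_derivative_def\<close>)
  moreover have "(\<Sum>j\<in>UNIV. axis j (v j)) = (\<chi> j. v j)" for v :: "'n \<Rightarrow> complex"
    by (simp add: vec_eq_iff axis_def if_distrib cong: if_cong)
  ultimately have "(w has_derivative (\<lambda>h. h *s (\<chi> j. w' j))) (at s within S)"
    by (simp add: vector_scalar_mult_def mult.commute)
  from diff_chain_within[OF this has_derivative_subset[OF D(1) wS]]
  have "((\<lambda>s. f (w s)) has_derivative (\<lambda>h. h * D (\<chi> j. w' j))) (at s within S)"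
    by (simp add: o_def D(2))
  then have "((\<lambda>s. f (w s)) has_field_derivative D (\<chi> j. w' j)) (at s within S)"
    by (rule has_derivative_imp_has_field_derivative) simp
  then show "\<exists>f'. ((\<lambda>s. f (w s)) has_field_derivative f') (at s within S)" ..
qed

text \<open>Lets two expansions be added over the union of their supports, although the definition
  sums over each exact support.\<close>

lemma nu_expansion_extend:
  assumes a: "nu_expansion g C s F a" and "finite A" "{\<alpha>. a I \<alpha> \<noteq> (\<lambda>_. 0)} \<subseteq> A"
    and "z \<in> C" "length I = s"
  shows "F z I = (\<Sum>\<alpha>\<in>A. a I \<alpha> z * (\<Prod>j\<in>UNIV. nu g j z ^ \<alpha> j))"
proof -
  have "F z I = (\<Sum>\<alpha> | a I \<alpha> \<noteq> (\<lambda>_. 0). a I \<alpha> z * (\<Prod>j\<in>UNIV. nu g j z ^ \<alpha> j))"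
    using a assms(4,5) by (auto simp: nu_expansion_def)
  also have "\<dots> = (\<Sum>\<alpha>\<in>A. a I \<alpha> z * (\<Prod>j\<in>UNIV. nu g j z ^ \<alpha> j))"
    by (rule sum.mono_neutral_left) (use assms(2,3) in auto)
  finally show ?thesis .
qed

lemma nu_expansion_lincomb:
  assumes a: "nu_expansion g C s F a" and a': "nu_expansion g C s F' a'"
  shows "nu_expansion g C s (scale_tf c F + F') (\<lambda>I \<alpha> z. c * a I \<alpha> z + a' I \<alpha> z)"
proof -
  let ?b = "\<lambda>I \<alpha> z. c * a I \<alpha> z + a' I \<alpha> z"
  let ?A = "\<lambda>I. {\<alpha>. a I \<alpha> \<noteq> (\<lambda>_. 0)} \<union> {\<alpha>. a' I \<alpha> \<noteq> (\<lambda>_. 0)}"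
  have fin: "finite (?A I)" for I
    using a a' by (auto simp: nu_expansion_def)
  have sub: "{\<alpha>. ?b I \<alpha> \<noteq> (\<lambda>_. 0)} \<subseteq> ?A I" for I by auto
  have "(scale_tf c F + F') z I = (\<Sum>\<alpha> | ?b I \<alpha> \<noteq> (\<lambda>_. 0). ?b I \<alpha> z * (\<Prod>j\<in>UNIV. nu g j z ^ \<alpha> j))"
    if "z \<in> C" "length I = s" for z I
  proof -
    have "(scale_tf c F + F') z I = (\<Sum>\<alpha>\<in>?A I. ?b I \<alpha> z * (\<Prod>j\<in>UNIV. nu g j z ^ \<alpha> j))"
      using nu_expansion_extend[OF a fin[of I] _ that] nu_expansion_extend[OF a' fin[of I] _ that]
      by (simp add: scale_tf_def sum_distrib_left sum.distrib algebra_simps)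
    also have "\<dots> = (\<Sum>\<alpha> | ?b I \<alpha> \<noteq> (\<lambda>_. 0). ?b I \<alpha> z * (\<Prod>j\<in>UNIV. nu g j z ^ \<alpha> j))"
      by (rule sum.mono_neutral_right) (use fin[of I] in \<open>auto simp: fun_eq_iff\<close>)
    finally show ?thesis .
  qed
  moreover have "finite {\<alpha>. ?b I \<alpha> \<noteq> (\<lambda>_. 0)}" for I
    using finite_subset[OF sub fin] .
  ultimately show ?thesis
    using a a' unfolding nu_expansion_def by (auto intro!: holo_on_lincomb)
qed

lemma nu_expansion_zero: "nu_expansion g C s (\<lambda>_ _. 0) (\<lambda>_ _ _. 0)"
  by (simp add: nu_expansion_def holo_on_zero)

section \<open>Explicit form of \<open>nu\<close> and uniqueness of expansions\<close>

lemma bilin_add_axis: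
  fixes g :: "'a::comm_ring_1 ^ 'n::finite ^ 'n"
  assumes "transpose g = g"
  shows "bilin g (y + axis j t) (y + axis j t) = bilin g y y + 2 * t * (g *v y) $ j + t\<^sup>2 * g $ j $ j"
proof -
  have "axis j t = t *s axis j 1" by (simp add: vec_eq_iff axis_def)
  then have "bilin g (axis j t) (axis j t) = t\<^sup>2 * g $ j $ j"
    by (simp add: bilin_simps bilin_axis_axis power2_eq_square)
  then show ?thesis
    using bilin_commute[OF assms, of y "axis j t"] by (simp add: bilin_simps bilin_axis_left)
qed

lemma cmat_mult_cvec: "cmat g *v cvec y = cvec (g *v y)"
  by (simp add: vec_eq_iff cvec_def matrix_vector_mult_def map_matrix_def)

text \<open>The logarithm depends on \<open>Im z\<close> alone, so the real direction contributes
  nothing. In the imaginary direction the argument is a quadratic in \<open>t\<close> with linear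
  coefficient \<open>2 (g y)\<close> at \<open>j\<close>; the Wirtinger factor
  \<open>- \<i> / 2\<close> gives the claim.\<close>

lemma nu_eq:
  fixes g :: "real ^ 'n::finite ^ 'n"
  assumes g: "transpose g = g" and pos: "bilin g (im_vec z) (im_vec z) > 0"
  shows "nu g j z = (cmat g *v nvec g z) $ j"
proof -
  let ?y = "im_vec z"
  let ?f = "\<lambda>z. complex_of_real (ln (bilin g (im_vec z) (im_vec z)))"
  have "im_vec (z + axis j (of_real t)) = ?y" for t
    by (simp add: vec_eq_iff im_vec_def axis_def)
  then have d1: "vector_derivative (\<lambda>t. ?f (z + axis j (of_real t))) (at 0) = 0"
    by simp
  have "im_vec (z + axis j (\<i> * of_real t)) = ?y + axis j t" for t
    by (simp add: vec_eq_iff im_vec_def axis_def)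
  then have eq: "(\<lambda>t. ?f (z + axis j (\<i> * of_real t))) =
      (\<lambda>t. of_real (ln (bilin g ?y ?y + 2 * t * (g *v ?y) $ j + t\<^sup>2 * g $ j $ j)))"
    by (simp add: bilin_add_axis[OF g])
  have "((\<lambda>t. ln (bilin g ?y ?y + 2 * t * (g *v ?y) $ j + t\<^sup>2 * g $ j $ j))
      has_real_derivative 2 * (g *v ?y) $ j / bilin g ?y ?y) (at 0)"
    using pos by (auto intro!: derivative_eq_intros)
  then have "((\<lambda>t. complex_of_real (ln (bilin g ?y ?y + 2 * t * (g *v ?y) $ j + t\<^sup>2 * g $ j $ j)))
      has_vector_derivative of_real (2 * (g *v ?y) $ j / bilin g ?y ?y)) (at 0)"
    by (intro has_vector_derivative_of_real)
      (simp add: has_real_derivative_iff_has_vector_derivative)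
  then have "vector_derivative (\<lambda>t. ?f (z + axis j (\<i> * of_real t))) (at 0) =
      of_real (2 * (g *v ?y) $ j / bilin g ?y ?y)"
    unfolding eq by (rule vector_derivative_at)
  moreover have "(cmat g *v nvec g z) $ j = - \<i> / of_real (bilin g ?y ?y) * of_real ((g *v ?y) $ j)"
    by (simp only: nvec_def vector_scalar_commute cmat_mult_cvec vector_smult_component)
      (simp add: cvec_def)
  ultimately show ?thesis
    unfolding nu_def wirtinger_def d1 by simp
qed

lemma nu_expansion_nvec:
  fixes g :: "real ^ 'n::finite ^ 'n"
  assumes g: "transpose g = g" and "bilin g (im_vec z) (im_vec z) > 0"
    and "nu_expansion g C s F a" "z \<in> C" "length I = s"
  shows "F z I = (\<Sum>\<alpha> | a I \<alpha> \<noteq> (\<lambda>_. 0).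
    a I \<alpha> z * (\<Prod>j\<in>UNIV. (cmat g *v nvec g z) $ j ^ \<alpha> j))"
  using assms by (simp add: nu_expansion_def nu_eq)

lemma line_poly_linear: "line_poly (\<lambda>v. (A *v v) $ j)"
  unfolding matrix_vector_mult_def by (simp add: line_poly_intros)

text \<open>The difference of two expansions is an expansion of zero, hence by the relation lemma a
  vanishing polynomial in \<open>g v\<close> for every \<open>v\<close>. Invertibility of
  \<open>g\<close> makes \<open>g v\<close> arbitrary, so all coefficients are zero.\<close>

lemma nu_expansion_unique:
  fixes g :: "real ^ 'n::finite ^ 'n"
  assumes C: "open C" and g: "transpose g = g" "invertible g"
    and pos: "\<And>z. z \<in> C \<Longrightarrow> bilin g (im_vec z) (im_vec z) > 0"
    and a: "nu_expansion g C s F a" and b: "nu_expansion g C s F b"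
  shows "a = b"
proof -
  define c where "c = (\<lambda>I \<alpha> z. (-1) * a I \<alpha> z + b I \<alpha> z)"
  have "scale_tf (-1) F + F = (\<lambda>_ _. 0)" by (simp add: scale_tf_def fun_eq_iff)
  then have c: "nu_expansion g C s (\<lambda>_ _. 0) c"
    using nu_expansion_lincomb[OF a b, of "-1"] by (simp add: c_def)
  have "c I \<alpha> z = 0" for I \<alpha> z
  proof (cases "z \<in> C \<and> length I = s \<and> c I \<alpha> \<noteq> (\<lambda>_. 0)")
    case True
    let ?A = "{\<alpha>. c I \<alpha> \<noteq> (\<lambda>_. 0)}"
    have fin: "finite ?A" and hol: "holo_on (c I \<alpha>) C" for \<alpha>
      using c by (auto simp: nu_expansion_def)
    have *: "(\<Sum>\<alpha>\<in>?A. c I \<alpha> z * (\<Prod>j\<in>UNIV. (cmat g *v v) $ j ^ \<alpha> j)) = 0" for v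
    proof (rule nvec_polynomial_relation[where Q = "\<lambda>z v. \<Sum>\<alpha>\<in>?A. c I \<alpha> z * (\<Prod>j\<in>UNIV. (cmat g *v v) $ j ^ \<alpha> j)"])
      fix v a b and S :: "complex set"
      assume "open S" "\<And>s. s \<in> S \<Longrightarrow> a + s *s b \<in> C"
      then show "(\<lambda>s. \<Sum>\<alpha>\<in>?A. c I \<alpha> (a + s *s b) * (\<Prod>j\<in>UNIV. (cmat g *v v) $ j ^ \<alpha> j)) holomorphic_on S"
        by (intro holomorphic_intros holo_on_compose[OF hol]) (auto intro!: holomorphic_intros)
    next
      fix z assume "z \<in> C"
      then show "(\<Sum>\<alpha>\<in>?A. c I \<alpha> z * (\<Prod>j\<in>UNIV. (cmat g *v nvec g z) $ j ^ \<alpha> j)) = 0"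
        using nu_expansion_nvec[OF g(1) pos c, of z I] True by simp
    qed (use C pos True in \<open>auto intro!: line_poly_intros line_poly_linear\<close>)
    obtain h where h: "g ** h = mat 1" using g(2) by (auto simp: invertible_def)
    have "cmat g ** cmat h = mat 1"
      using h by (simp add: vec_eq_iff matrix_matrix_mult_def mat_def map_matrix_def
          flip: of_real_mult of_real_sum)
    then have "cmat g *v (cmat h *v v) = v" for v
      by (simp add: matrix_vector_mul_assoc)
    then have "(\<Sum>\<alpha>\<in>?A. c I \<alpha> z * (\<Prod>j\<in>UNIV. v $ j ^ \<alpha> j)) = 0" for v
      using *[of "cmat h *v v"] by simp
    from monomial_sum_zero[OF fin this] True show ?thesis by blast
  next
    case False
    then show ?thesis using c by (auto simp: nu_expansion_def)
  qed
  then show ?thesis by (simp add: c_def fun_eq_iff)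
qed

section \<open>Linear structure on modular forms and linearity of \<open>ct\<close>\<close>

lemma slash_lincomb: "slash g P k s (scale_tf c F + F') = scale_tf c (slash g P k s F) + slash g P k s F'"
  by (simp add: fun_eq_iff slash_def scale_tf_def sum_distrib_left sum.distrib algebra_simps)

lemma lowering_lincomb:
  "lowering g (\<lambda>I \<alpha> z. c * a I \<alpha> z + b I \<alpha> z) = (\<lambda>I \<alpha> z. c * lowering g a I \<alpha> z + lowering g b I \<alpha> z)"
  by (simp add: lowering_def fun_eq_iff sum_distrib_left sum.distrib algebra_simps)

lemma lowering_pow_lincomb:
  "(lowering g ^^ d) (\<lambda>I \<alpha> z. c * a I \<alpha> z + b I \<alpha> z) =
    (\<lambda>I \<alpha> z. c * (lowering g ^^ d) a I \<alpha> z + (lowering g ^^ d) b I \<alpha> z)"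
proof (induction d)
  case (Suc d)
  then show ?case by (simp only: funpow.simps o_apply lowering_lincomb)
qed simp

lemma lowering_pow_zero: "(lowering g ^^ d) (\<lambda>_ _ _. 0) = (\<lambda>_ _ _. 0)"
  by (induction d) (simp_all add: lowering_def)

text \<open>Both series run over the same index set, the closed cone, and so combine
  termwise.\<close>

lemma cusp_fourier_lincomb:
  assumes "cusp_fourier g C f" "cusp_fourier g C h"
  shows "cusp_fourier g C (\<lambda>z. b * f z + h z)"
proof -
  obtain c d where
    "\<forall>z\<in>C. ((\<lambda>\<alpha>. c \<alpha> * exp (2 * of_real pi * \<i> * bilin (cmat g) (\<chi> i. of_real (\<alpha> $ i)) z))
        has_sum f z) (closure (im_vec ` C))"
    "\<forall>z\<in>C. ((\<lambda>\<alpha>. d \<alpha> * exp (2 * of_real pi * \<i> * bilin (cmat g) (\<chi> i. of_real (\<alpha> $ i)) z))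
        has_sum h z) (closure (im_vec ` C))"
    using assms unfolding cusp_fourier_def by blast
  then have "\<forall>z\<in>C. ((\<lambda>\<alpha>. (b * c \<alpha> + d \<alpha>) * exp (2 * of_real pi * \<i> * bilin (cmat g) (\<chi> i. of_real (\<alpha> $ i)) z))
        has_sum (b * f z + h z)) (closure (im_vec ` C))"
    by (auto simp: distrib_right mult.assoc intro!: has_sum_add has_sum_cmult_right)
  then show ?thesis
    unfolding cusp_fourier_def by (intro exI[of _ "\<lambda>\<alpha>. b * c \<alpha> + d \<alpha>"])
qed

lemma cusp_fourier_zero: "cusp_fourier g C (\<lambda>_. 0)"
  unfolding cusp_fourier_def by (intro exI[of _ "\<lambda>_. 0"]) auto

lemma cusp_condition_lincomb:
  assumes "cusp_condition G D k s F" "cusp_condition G D k s F'"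
  shows "cusp_condition G D k s (scale_tf c F + F')"
  unfolding cusp_condition_def Let_def
proof (intro allI impI)
  fix P g' assume P: "cusp_frame G P g'"
  let ?C = "tube g' {Z. cmat P *v Z \<in> D}"
  obtain a where a: "nu_expansion g' ?C s (slash g' P k s F) a"
    "\<And>d I. length I = s + d \<Longrightarrow> cusp_fourier g' ?C (((lowering g' ^^ d) a) I (\<lambda>_. 0))"
    using assms(1) P unfolding cusp_condition_def Let_def by blast
  obtain b where b: "nu_expansion g' ?C s (slash g' P k s F') b"
    "\<And>d I. length I = s + d \<Longrightarrow> cusp_fourier g' ?C (((lowering g' ^^ d) b) I (\<lambda>_. 0))"
    using assms(2) P unfolding cusp_condition_def Let_def by blast
  show "\<exists>a. nu_expansion g' ?C s (slash g' P k s (scale_tf c F + F')) a \<and>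
     (\<forall>d I. length I = s + d \<longrightarrow> cusp_fourier g' ?C (((lowering g' ^^ d) a) I (\<lambda>_. 0)))"
    using nu_expansion_lincomb[OF a(1) b(1), of c] cusp_fourier_lincomb[OF a(2) b(2), where b = c]
    by (intro exI[of _ "\<lambda>I \<alpha> z. c * a I \<alpha> z + b I \<alpha> z"])
      (simp add: slash_lincomb lowering_pow_lincomb)
qed

lemma slash_zero: "slash g P k s (\<lambda>_ _. 0) = (\<lambda>_ _. 0)"
  by (simp add: slash_def)

lemma cusp_condition_zero: "cusp_condition G D k s (\<lambda>_ _. 0)"
  unfolding cusp_condition_def Let_def
  by (auto intro!: exI[of _ "\<lambda>_ _ _. 0"] nu_expansion_zero
      simp: slash_zero lowering_pow_zero cusp_fourier_zero)

lemma AHMod_lincomb: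
  fixes G :: "int ^ 'n::finite ^ 'n"
  assumes "open (tube (rmat G) D)" "F \<in> AHMod G D \<Gamma> k s" "F' \<in> AHMod G D \<Gamma> k s"
  shows "scale_tf c F + F' \<in> AHMod G D \<Gamma> k s"
proof -
  let ?C = "tube (rmat G) D"
  have "smooth_fun_on (\<lambda>z. (scale_tf c F + F') z I) ?C" for I
    using assms unfolding AHMod_def Let_def smooth_fun_on_def
    by (auto simp: scale_tf_def intro!: Ck_on_lincomb)
  moreover have "\<exists>a. nu_expansion (rmat G) ?C s (scale_tf c F + F') a"
    using assms nu_expansion_lincomb unfolding AHMod_def Let_def by blast
  moreover have "supported ?C s (scale_tf c F + F')"
    using assms(2,3) by (auto simp: AHMod_def Let_def supported_def scale_tf_def)
  moreover have "slash (rmat G) (rmat \<gamma>) k s (scale_tf c F + F') z I = (scale_tf c F + F') z I"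
    if "\<gamma> \<in> \<Gamma>" "z \<in> ?C" "length I = s" for \<gamma> z I
  proof -
    have "slash (rmat G) (rmat \<gamma>) k s F z I = F z I" "slash (rmat G) (rmat \<gamma>) k s F' z I = F' z I"
      using assms(2,3) that unfolding AHMod_def Let_def by blast+
    then show ?thesis by (simp add: slash_lincomb) (simp add: scale_tf_def)
  qed
  moreover have "CARD('n) \<le> 2 \<longrightarrow> cusp_condition G D k s (scale_tf c F + F')"
    using assms(2,3) by (simp add: AHMod_def Let_def cusp_condition_lincomb)
  ultimately show ?thesis
    unfolding AHMod_def Let_def by blast
qed

lemma AHMod_zero: "(\<lambda>_ _. 0) \<in> AHMod G D \<Gamma> k s"
  unfolding AHMod_def Let_def smooth_fun_on_def
  by (auto simp: Ck_on_zero supported_def cusp_condition_zero slash_def intro: nu_expansion_zero)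

text \<open>Uniqueness resolves the description operator in \<open>ct\<close>, so any expansion at
  hand computes the constant term.\<close>

lemma ct_eq:
  fixes g :: "real ^ 'n::finite ^ 'n"
  assumes "open C" "transpose g = g" "invertible g"
    and "\<And>z. z \<in> C \<Longrightarrow> bilin g (im_vec z) (im_vec z) > 0"
    and "nu_expansion g C s F a"
  shows "ct g C s F = (\<lambda>z I. a I (\<lambda>_. 0) z)"
proof -
  have "(THE a. nu_expansion g C s F a) = a"
    using assms nu_expansion_unique by blast
  then show ?thesis by (simp add: ct_def)
qed

interpretation tf: module "scale_tf :: complex \<Rightarrow> 'n tensor_fun \<Rightarrow> 'n tensor_fun"
  by unfold_locales (auto simp: scale_tf_def fun_eq_iff algebra_simps)

lemma tensor_subspaceI:
  assumes "(\<lambda>_ _. 0) \<in> V" "\<And>c F F'. F \<in> V \<Longrightarrow> F' \<in> V \<Longrightarrow> scale_tf c F + F' \<in> V"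
  shows "module.subspace scale_tf V"
proof (rule tf.subspaceI)
  show "0 \<in> V" using assms(1) by (simp add: zero_fun_def)
  have "scale_tf 1 F + F' = F + F'" for F F' :: "'a tensor_fun"
    by (simp add: scale_tf_def fun_eq_iff)
  then show "F + F' \<in> V" if "F \<in> V" "F' \<in> V" for F F' using assms(2)[OF that, of 1] by simp
  have "scale_tf c F + (\<lambda>_ _. 0) = scale_tf c F" for c and F :: "'a tensor_fun"
    by (simp add: scale_tf_def fun_eq_iff)
  then show "scale_tf c F \<in> V" if "F \<in> V" for c F using assms(2)[OF that assms(1), of c] by simp
qed

text \<open>Surjectivity is built into \<open>QMod\<close>, once the image is seen to be supported
  on the tube and holomorphic. What remains is linearity, and by linearity injectivity reduces to
  the trivial kernel assumed in \<open>inj\<close>.\<close>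

lemma linear_iso_between_ct:
  fixes G :: "int ^ 'n::finite ^ 'n"
  assumes C: "open (tube (rmat G) D)" and g: "transpose (rmat G) = rmat G" "invertible (rmat G)"
    and inj: "\<And>F. F \<in> AHMod G D \<Gamma> k s \<Longrightarrow> ct (rmat G) (tube (rmat G) D) s F = (\<lambda>_ _. 0) \<Longrightarrow> F = (\<lambda>_ _. 0)"
  shows "linear_iso_between (ct (rmat G) (tube (rmat G) D) s) (AHMod G D \<Gamma> k s) (QMod G D \<Gamma> k s)"
proof -
  let ?g = "rmat G" and ?C = "tube (rmat G) D" and ?A = "AHMod G D \<Gamma> k s"
  let ?T = "ct ?g ?C s"
  have pos: "bilin ?g (im_vec z) (im_vec z) > 0" if "z \<in> ?C" for z
    using that by (simp add: tube_def)
  have expansion: "\<exists>a. nu_expansion ?g ?C s F a" if "F \<in> ?A" for F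
    using that by (auto simp: AHMod_def Let_def)
  note ct = ct_eq[OF C g pos]
  have lin: "?T (scale_tf c F + F') = scale_tf c (?T F) + ?T F'" if F: "F \<in> ?A" "F' \<in> ?A" for c F F'
  proof -
    obtain a b where ab: "nu_expansion ?g ?C s F a" "nu_expansion ?g ?C s F' b"
      using expansion F by blast
    show ?thesis
      using ct[OF _ nu_expansion_lincomb[OF ab, of c]] ct[OF _ ab(1)] ct[OF _ ab(2)]
      by (simp add: scale_tf_def fun_eq_iff)
  qed
  have "?T F \<in> QMod G D \<Gamma> k s" if F: "F \<in> ?A" for F
  proof -
    obtain a where a: "nu_expansion ?g ?C s F a" using expansion F by blast
    then have "holo_on (a I (\<lambda>_. 0)) ?C" and "z \<notin> ?C \<or> length I \<noteq> s \<Longrightarrow> a I (\<lambda>_. 0) z = 0" for I z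
      by (auto simp: nu_expansion_def)
    then have "supported ?C s (?T F)" "\<forall>I. holo_on (\<lambda>z. ?T F z I) ?C"
      using ct[OF _ a] by (auto simp: supported_def)
    then show ?thesis using F unfolding QMod_def Let_def by blast
  qed
  then have image: "?T ` ?A = QMod G D \<Gamma> k s"
    unfolding QMod_def Let_def by auto
  have zero: "?T (\<lambda>_ _. 0) = (\<lambda>_ _. 0)"
    using ct[OF _ nu_expansion_zero] by simp
  have scale: "?T (scale_tf c F) = scale_tf c (?T F)" if "F \<in> ?A" for c F
  proof -
    have "H + (\<lambda>_ _. 0) = H" for H :: "'n tensor_fun" by (simp add: fun_eq_iff)
    then show ?thesis using lin[OF that AHMod_zero, of c] by (simp only: zero)
  qed
  have add: "?T (F + F') = ?T F + ?T F'" if "F \<in> ?A" "F' \<in> ?A" for F F'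
    using lin[OF that, of 1] by (simp add: tf.scale_one)
  have "inj_on ?T ?A"
  proof (rule inj_onI)
    fix F F' assume F: "F \<in> ?A" "F' \<in> ?A" "?T F = ?T F'"
    have "?T (scale_tf (-1) F' + F) = (\<lambda>_ _. 0)"
      using lin[OF F(2,1), of "-1"] F(3) by (simp add: scale_tf_def fun_eq_iff)
    from inj[OF AHMod_lincomb[OF C F(2,1)] this]
    show "F = F'" by (simp add: scale_tf_def fun_eq_iff)
  qed
  moreover have "module.subspace scale_tf ?A"
    by (intro tensor_subspaceI AHMod_zero AHMod_lincomb C)
  moreover have "module.subspace scale_tf (?T ` ?A)"
  proof (rule tensor_subspaceI)
    show "(\<lambda>_ _. 0) \<in> ?T ` ?A" using zero AHMod_zero by (metis imageI)
    show "scale_tf c F + F' \<in> ?T ` ?A" if "F \<in> ?T ` ?A" "F' \<in> ?T ` ?A" for c F F'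
      using that lin AHMod_lincomb[OF C] by (auto simp flip: lin)
  qed
  ultimately show ?thesis
    using add scale unfolding linear_iso_between_def bij_betw_def image by blast
qed

section \<open>Eichler transvections on the tube domain\<close>

lemma cvec_nth [simp]: "cvec y $ i = of_real (y $ i)"
  by (simp add: cvec_def)

definition vcnj :: "complex ^ 'n \<Rightarrow> complex ^ 'n" where
  "vcnj z = (\<chi> i. cnj (z $ i))"

lemma vcnj_nth [simp]: "vcnj z $ i = cnj (z $ i)"
  by (simp add: vcnj_def)

lemma vcnj_eq: "vcnj z = z - (2 * \<i>) *s cvec (im_vec z)"
  by (simp add: vec_eq_iff im_vec_def complex_eq_iff)

lemma vcnj_cvec [simp]: "vcnj (cvec u) = cvec u"
  by (simp add: vec_eq_iff)

lemma cmat_nth [simp]: "cmat g $ i $ j = of_real (g $ i $ j)"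
  by (simp add: map_matrix_def)

lemma bilin_cvec: "bilin (cmat g) (cvec x) (cvec y) = of_real (bilin g x y)"
  by (simp add: bilin_def)

lemma cnj_bilin: "cnj (bilin (cmat g) x y) = bilin (cmat g) (vcnj x) (vcnj y)"
  by (simp add: bilin_def)

lemma transpose_cmat: "transpose g = g \<Longrightarrow> transpose (cmat g) = cmat g"
  by (simp add: transpose_def map_matrix_def vec_eq_iff)

lemma cmat_hyp_gram: "cmat (hyp_gram g) = hyp_gram (cmat g)"
  by (auto simp: vec_eq_iff hyp_gram_def split: hyp.splits)

lemma phi_nth [simp]:
  "phi g z $ HE = - (1/2) * bilin (cmat g) z z" "phi g z $ HF = 1" "phi g z $ Lat i = z $ i"
  by (simp_all add: phi_def)

lemma lat_phi [simp]: "lat (phi g z) = z"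
  by (simp add: vec_eq_iff)

lemma period_coneD:
  assumes "Z \<in> period_cone g"
  shows "bilin (hyp_gram (cmat g)) Z Z = 0" "Re (bilin (hyp_gram (cmat g)) Z (vcnj Z)) > 0"
  using assms by (simp_all add: period_cone_def cmat_hyp_gram vcnj_def)

lemma period_coneI:
  assumes "bilin (hyp_gram (cmat g)) Z Z = 0" "Re (bilin (hyp_gram (cmat g)) Z (vcnj Z)) > 0"
  shows "Z \<in> period_cone g"
  using assms by (simp_all add: period_cone_def cmat_hyp_gram vcnj_def)

lemma phi_isotropic: "bilin (hyp_gram (cmat g)) (phi g z) (phi g z) = 0"
  for g :: "real ^ 'n::finite ^ 'n"
  by (simp add: bilin_hyp)

lemma lat_vcnj: "lat (vcnj Z) = vcnj (lat Z)"
  by (simp add: vec_eq_iff)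

lemma phi_norm:
  fixes g :: "real ^ 'n::finite ^ 'n"
  assumes "transpose g = g"
  shows "bilin (hyp_gram (cmat g)) (phi g z) (vcnj (phi g z)) =
    of_real (2 * bilin g (im_vec z) (im_vec z))"
proof -
  let ?y = "cvec (im_vec z)"
  have "bilin (cmat g) ?y z = bilin (cmat g) z ?y"
    by (rule bilin_commute[OF transpose_cmat[OF assms]])
  then show ?thesis
    by (simp add: bilin_hyp lat_vcnj cnj_bilin vcnj_eq[of z] bilin_simps field_simps
        flip: bilin_cvec)
qed

lemma phi_in_period_cone:
  fixes g :: "real ^ 'n::finite ^ 'n"
  assumes "transpose g = g" "bilin g (im_vec z) (im_vec z) > 0"
  shows "phi g z \<in> period_cone g"
  using assms by (intro period_coneI phi_isotropic) (simp add: phi_norm)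

text \<open>The means of staying in \<open>D\<close>: a connected parameter space whose image meets
  \<open>D\<close>. It is used with the punctured plane for scalars, the unit interval for
  transvections, and balls for \<open>phi g\<close>.\<close>

lemma components_image:
  assumes "D \<in> components S" "connected T" "continuous_on T f" "f ` T \<subseteq> S"
    and "t0 \<in> T" "f t0 \<in> D" "t \<in> T"
  shows "f t \<in> D"
proof -
  have "f ` T \<subseteq> D"
    by (rule components_maximal[OF assms(1)])
      (use assms connected_continuous_image in auto)
  then show ?thesis using assms(7) by blast
qed

lemma period_cone_component_scale:
  fixes g :: "real ^ 'n::finite ^ 'n"
  assumes D: "D \<in> components (period_cone g)" and "Z \<in> D" "c \<noteq> 0"
  shows "c *s Z \<in> D"
proof (rule components_image[OF D, of "- {0}" "\<lambda>c. c *s Z" 1 c])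
  have Z: "Z \<in> period_cone g" using D \<open>Z \<in> D\<close> in_components_subset by blast
  show "(\<lambda>c. c *s Z) ` (- {0}) \<subseteq> period_cone g"
  proof (intro image_subsetI period_coneI)
    fix c :: complex assume c: "c \<in> - {0}"
    have "vcnj (c *s Z) = cnj c *s vcnj Z" by (simp add: vec_eq_iff)
    then have "bilin (hyp_gram (cmat g)) (c *s Z) (vcnj (c *s Z)) =
        of_real ((cmod c)\<^sup>2) * bilin (hyp_gram (cmat g)) Z (vcnj Z)"
      by (simp add: bilin_simps complex_norm_square mult_ac del: of_real_power)
    then show "Re (bilin (hyp_gram (cmat g)) (c *s Z) (vcnj (c *s Z))) > 0"
      using period_coneD[OF Z] c by (simp del: of_real_power)
  qed (simp add: bilin_simps period_coneD[OF Z])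
  show "connected (- {0::complex})" by (rule connected_punctured_universe) simp
qed (use assms in \<open>auto simp: vector_scalar_mult_def intro!: continuous_intros\<close>)

definition real_eichler :: "real ^ 'n ^ 'n \<Rightarrow> real ^ 'n \<Rightarrow> complex ^ 'n hyp ^ 'n hyp" where
  "real_eichler g u = eichler (cmat g) (cvec u) (of_real (bilin g u u / 2))"

lemma real_eichler_isometry:
  fixes g :: "real ^ 'n::finite ^ 'n"
  assumes "transpose g = g"
  shows "bilin (hyp_gram (cmat g)) (real_eichler g u *v Z) (real_eichler g u *v W) =
    bilin (hyp_gram (cmat g)) Z W"
  unfolding real_eichler_def
  by (rule eichler_isometry[OF transpose_cmat[OF assms]]) (simp add: bilin_cvec)

lemma vcnj_real_eichler: "vcnj (real_eichler g u *v Z) = real_eichler g u *v vcnj Z"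
  for g :: "real ^ 'n::finite ^ 'n"
  by (simp add: vec_eq_iff[of "vcnj _"] forall_hyp real_eichler_def eichler_mult cnj_bilin lat_vcnj)

text \<open>Shrinking \<open>u\<close> to 0 gives a path of real isometries from the transvection to
  the identity, along which the image of \<open>Z\<close> never leaves the period cone.\<close>

lemma real_eichler_component:
  fixes g :: "real ^ 'n::finite ^ 'n"
  assumes D: "D \<in> components (period_cone g)" and g: "transpose g = g" and "Z \<in> D"
  shows "real_eichler g u *v Z \<in> D"
proof -
  have Z: "Z \<in> period_cone g" using D \<open>Z \<in> D\<close> in_components_subset by blast
  have "(\<lambda>t. real_eichler g (t *\<^sub>R u) *v Z) ` {0..1} \<subseteq> period_cone g"
    by (intro image_subsetI period_coneI)
      (simp_all only: vcnj_real_eichler real_eichler_isometry[OF g] period_coneD[OF Z])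
  moreover have "continuous_on {0..1} (\<lambda>t. real_eichler g (t *\<^sub>R u) *v Z)"
  proof -
    have "continuous_on {0..1} (\<lambda>t. (real_eichler g (t *\<^sub>R u) *v Z) $ a)" for a
      unfolding real_eichler_def
      by (cases a) (simp_all only: eichler_mult cvec_def, (intro continuous_intros; simp)+)
    then have "continuous_on {0..1} (\<lambda>t. \<chi> a. (real_eichler g (t *\<^sub>R u) *v Z) $ a)"
      by (rule continuous_on_vec_lambda)
    then show ?thesis by simp
  qed
  moreover have "real_eichler g (0 *\<^sub>R u) *v Z = Z"
  proof -
    have "cvec (0 *\<^sub>R u) = 0" "bilin g (0 *\<^sub>R u) (0 *\<^sub>R u) = 0"
      by (simp_all add: vec_eq_iff bilin_def)
    then show ?thesis by (simp add: real_eichler_def eichler_0)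
  qed
  ultimately have "real_eichler g (1 *\<^sub>R u) *v Z \<in> D"
    using \<open>Z \<in> D\<close> by (intro components_image[OF D, of "{0..1}" "\<lambda>t. real_eichler g (t *\<^sub>R u) *v Z" 0 1]) auto
  then show ?thesis by simp
qed

lemma continuous_on_im_vec [continuous_intros]:
  "continuous_on S f \<Longrightarrow> continuous_on S (\<lambda>x. im_vec (f x))"
  unfolding im_vec_def by (intro continuous_intros)

lemma continuous_on_phi: "continuous_on S (phi g)"
  for g :: "real ^ 'n::finite ^ 'n"
proof -
  have "continuous_on S (\<lambda>z. phi g z $ a)" for a
    by (cases a) (auto intro!: continuous_intros)
  then have "continuous_on S (\<lambda>z. \<chi> a. phi g z $ a)" by (rule continuous_on_vec_lambda)
  then show ?thesis by (simp add: eta_contract_eq)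
qed

text \<open>A ball on which the norm of the imaginary part stays positive is connected and mapped by
  \<open>phi g\<close> into the period cone, hence into the same component as its centre.\<close>

lemma open_tube:
  fixes g :: "real ^ 'n::finite ^ 'n"
  assumes D: "D \<in> components (period_cone g)" and g: "transpose g = g"
  shows "open (tube g D)"
  unfolding open_contains_ball
proof
  fix z assume z: "z \<in> tube g D"
  let ?U = "{z. bilin g (im_vec z) (im_vec z) > 0}"
  have "open ?U"
    by (intro open_Collect_less continuous_intros)
  then obtain e where e: "e > 0" "ball z e \<subseteq> ?U"
    using z by (force simp: tube_def open_contains_ball)
  have "phi g w \<in> D" if "w \<in> ball z e" for w
    using z e that by (intro components_image[OF D, of "ball z e" "phi g" z w] continuous_on_phi)
      (auto simp: tube_def intro!: phi_in_period_cone[OF g])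
  then show "\<exists>e>0. ball z e \<subseteq> tube g D"
    using e by (auto simp: tube_def)
qed

text \<open>For real \<open>u\<close> this is the automorphy factor of the transvection, the
  \<open>HF\<close> coordinate of the image of \<open>phi g z\<close>. It is stated for complex
  \<open>u\<close> because the vanishing will be extended polynomially in \<open>u\<close>.\<close>

definition eichler_J :: "real ^ 'n ^ 'n \<Rightarrow> complex ^ 'n \<Rightarrow> complex ^ 'n \<Rightarrow> complex" where
  "eichler_J g u z = 1 - bilin (cmat g) z u + bilin (cmat g) u u * bilin (cmat g) z z / 4"

definition eichler_act :: "real ^ 'n ^ 'n \<Rightarrow> complex ^ 'n \<Rightarrow> complex ^ 'n \<Rightarrow> complex ^ 'n" where
  "eichler_act g u z = (1 / eichler_J g u z) *s (z - (bilin (cmat g) z z / 2) *s u)"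

text \<open>\<open>g\<^sup>-\<^sup>1\<close> applied to the gradient of \<open>eichler_J g u\<close> at \<open>z\<close>.\<close>

definition eichler_grad :: "real ^ 'n ^ 'n \<Rightarrow> complex ^ 'n \<Rightarrow> complex ^ 'n \<Rightarrow> complex ^ 'n" where
  "eichler_grad g u z = (bilin (cmat g) u u / 2) *s z - u"

lemma real_eichler_phi:
  fixes g :: "real ^ 'n::finite ^ 'n"
  shows "(real_eichler g u *v phi g z) $ HE = - (1/2) * bilin (cmat g) z z"
    and "(real_eichler g u *v phi g z) $ HF = eichler_J g (cvec u) z"
    and "lat (real_eichler g u *v phi g z) = z - (bilin (cmat g) z z / 2) *s cvec u"
  by (simp_all add: real_eichler_def eichler_mult lat_eichler eichler_J_def bilin_cvec)

lemma phi_eichler_act: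
  fixes g :: "real ^ 'n::finite ^ 'n"
  assumes g: "transpose g = g" and J: "eichler_J g (cvec u) z \<noteq> 0"
  shows "phi g (eichler_act g (cvec u) z) = (1 / eichler_J g (cvec u) z) *s (real_eichler g u *v phi g z)"
proof -
  let ?B = "bilin (cmat g)" and ?u = "cvec u"
  let ?w = "z - (?B z z / 2) *s ?u"
  have "?B ?u z = ?B z ?u" by (rule bilin_commute[OF transpose_cmat[OF g]])
  \<comment> \<open>Isotropy of the transformed vector in coordinates; it makes the
    \<open>HE\<close> coordinates of both sides agree.\<close>
  then have *: "?B ?w ?w = ?B z z * eichler_J g ?u z"
    by (simp add: bilin_simps eichler_J_def algebra_simps)
  have "phi g (eichler_act g ?u z) $ a =
      ((1 / eichler_J g ?u z) *s (real_eichler g u *v phi g z)) $ a" for a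
  proof (cases a)
    case HE
    have "?B (eichler_act g ?u z) (eichler_act g ?u z) = ?B z z / eichler_J g ?u z"
      unfolding eichler_act_def bilin_scale_left bilin_scale_right * using J by simp
    then show ?thesis using HE by (simp add: real_eichler_phi)
  next
    case HF
    then show ?thesis using J by (simp add: real_eichler_phi)
  next
    case (Lat i)
    have "(real_eichler g u *v phi g z) $ Lat i = ?w $ i"
      using real_eichler_phi(3)[of g u z] by (metis lat_nth)
    then show ?thesis using Lat by (simp add: eichler_act_def diff_divide_distrib)
  qed
  then show ?thesis by (simp add: vec_eq_iff)
qed

text \<open>Both norms are half the hermitian norms of the corresponding \<open>phi\<close>. A
  transvection with real \<open>u\<close> commutes with conjugation and preserves the form, so only
  the scalar \<open>1 / J\<close> and its conjugate matter.\<close>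

lemma im_vec_eichler_act:
  fixes g :: "real ^ 'n::finite ^ 'n"
  assumes g: "transpose g = g" and J: "eichler_J g (cvec u) z \<noteq> 0"
  defines "w \<equiv> eichler_act g (cvec u) z"
  shows "complex_of_real (bilin g (im_vec w) (im_vec w)) =
    bilin g (im_vec z) (im_vec z) / (eichler_J g (cvec u) z * cnj (eichler_J g (cvec u) z))"
proof -
  let ?J = "eichler_J g (cvec u) z"
  have vcnj: "vcnj ((1 / ?J) *s Z) = (1 / cnj ?J) *s vcnj Z" for Z by (simp add: vec_eq_iff)
  have "complex_of_real (2 * bilin g (im_vec w) (im_vec w)) =
      bilin (hyp_gram (cmat g)) (phi g w) (vcnj (phi g w))"
    by (rule phi_norm[OF g, symmetric])
  also have "\<dots> = 1 / (?J * cnj ?J) * bilin (hyp_gram (cmat g)) (phi g z) (vcnj (phi g z))"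
    unfolding w_def phi_eichler_act[OF g J]
    by (simp only: vcnj vcnj_real_eichler bilin_scale_left bilin_scale_right real_eichler_isometry[OF g]) simp
  also have "\<dots> = 2 * (bilin g (im_vec z) (im_vec z) / (?J * cnj ?J))"
    by (simp add: phi_norm[OF g])
  finally show ?thesis by (simp only: of_real_mult of_real_numeral mult_cancel_left) simp
qed

lemma eichler_act_in_tube:
  fixes g :: "real ^ 'n::finite ^ 'n"
  assumes D: "D \<in> components (period_cone g)" and g: "transpose g = g"
    and z: "z \<in> tube g D" and J: "eichler_J g (cvec u) z \<noteq> 0"
  shows "eichler_act g (cvec u) z \<in> tube g D"
proof -
  let ?J = "eichler_J g (cvec u) z" and ?w = "eichler_act g (cvec u) z"
  have "phi g ?w \<in> D"
    unfolding phi_eichler_act[OF g J]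
    using z J by (intro period_cone_component_scale[OF D] real_eichler_component[OF D g])
      (auto simp: tube_def)
  moreover from this have "phi g ?w \<in> period_cone g" using D in_components_subset by blast
  then have "bilin g (im_vec ?w) (im_vec ?w) > 0"
    using period_coneD(2) phi_norm[OF g] by fastforce
  ultimately show ?thesis by (simp add: tube_def)
qed

text \<open>The transformation law of \<open>n(z)\<close>: subtracting
  \<open>g\<inverse> d log J\<close> gives \<open>m\<close>, on which the transvection acts
  linearly. The proof expresses both sides by a few inner products and compares coordinates.\<close>

lemma nvec_eichler_act:
  fixes g :: "real ^ 'n::finite ^ 'n"
  assumes g: "transpose g = g" and J: "eichler_J g (cvec u) z \<noteq> 0"
    and pos: "bilin g (im_vec z) (im_vec z) > 0"
  defines "c \<equiv> eichler_grad g (cvec u) z"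
  defines "m \<equiv> nvec g z - (1 / eichler_J g (cvec u) z) *s c"
  shows "nvec g (eichler_act g (cvec u) z) =
    eichler_J g (cvec u) z *s (m - bilin (cmat g) z m *s cvec u)
      - bilin (cmat g) c m *s (z - (bilin (cmat g) z z / 2) *s cvec u)"
proof -
  let ?B = "bilin (cmat g)"
  define U where "U = cvec u"
  define y where "y = cvec (im_vec z)"
  define q where "q = complex_of_real (bilin g (im_vec z) (im_vec z))"
  define jj where "jj = eichler_J g U z"
  define w where "w = eichler_act g U z"
  have q0: "q \<noteq> 0" using pos by (simp add: q_def)
  have J0: "jj \<noteq> 0" using J by (simp add: jj_def U_def)
  have comm: "?B x y = ?B y x" for x y by (rule bilin_commute[OF transpose_cmat[OF g]])
  \<comment> \<open>With these scalars and the coordinates of \<open>z\<close>, \<open>y\<close>,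
    \<open>U\<close>, the claim becomes an identity of rational functions; the conjugates follow
    from replacing \<open>z\<close> by \<open>z - 2 \<i> y\<close>.\<close>
  define zz uz uu zy uy where s: "zz = ?B z z" "uz = ?B z U" "uu = ?B U U" "zy = ?B z y" "uy = ?B U y"
  have s': "?B U z = uz" "?B y z = zy" "?B y U = uy" "?B y y = q"
    by (simp_all add: s comm y_def q_def bilin_cvec)
  note ss = s[symmetric] s'
  have jj: "jj = 1 - uz + uu * zz / 4" by (simp add: jj_def eichler_J_def ss)
  have vU: "vcnj U = U" by (simp add: vec_eq_iff U_def)
  have vz: "vcnj z = z - (2 * \<i>) *s y" by (simp add: vcnj_eq y_def)
  have cz: "cnj zz = zz - 4 * \<i> * zy - 4 * q"
    unfolding s(1) cnj_bilin vz by (simp add: bilin_simps ss algebra_simps)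
  have cJ: "cnj jj = jj - 2 * \<i> * (uu / 2 * zy - uy) - uu * q"
  proof -
    have "cnj uz = uz - 2 * \<i> * uy" "cnj uu = uu"
      unfolding s(2,3) cnj_bilin vz vU by (simp_all add: bilin_simps ss)
    then show ?thesis by (simp add: jj cz) (simp add: field_simps)
  qed
  have cJ0: "cnj jj \<noteq> 0" using J0 by simp
  have im: "cvec (im_vec w) $ i = (w $ i - cnj (w $ i)) / (2 * \<i>)" for i
    by (simp add: im_vec_def complex_eq_iff)
  have w: "w $ i = (z $ i - zz / 2 * U $ i) / jj" for i
    by (simp add: w_def eichler_act_def jj_def[symmetric] ss diff_divide_distrib)
  have cw: "cnj (w $ i) = (z $ i - 2 * \<i> * y $ i - cnj zz / 2 * U $ i) / cnj jj" for i
  proof -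
    have "cnj (z $ i) = z $ i - 2 * \<i> * y $ i" using vz by (metis vcnj_nth vector_minus_component vector_smult_component)
    moreover have "cnj (U $ i) = U $ i" using vU by (metis vcnj_nth)
    ultimately show ?thesis by (simp add: w)
  qed
  have qw: "complex_of_real (bilin g (im_vec w) (im_vec w)) = q / (jj * cnj jj)"
    using im_vec_eichler_act[OF g J] by (simp add: w_def U_def q_def jj_def)
  have nw: "nvec g w $ i = - (cnj jj * (z $ i - zz / 2 * U $ i)
      - jj * (z $ i - 2 * \<i> * y $ i - cnj zz / 2 * U $ i)) / (2 * q)" for i
    unfolding nvec_def vector_smult_component im qw cw unfolding w
    using q0 J0 cJ0 by (simp add: field_simps)
  have nz: "nvec g z = (- \<i> / q) *s y" by (simp add: nvec_def y_def q_def)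
  have c: "c = (uu / 2) *s z - U" by (simp add: c_def eichler_grad_def ss U_def[symmetric])
  have m: "m = (- \<i> / q) *s y - (1 / jj) *s c" by (simp add: m_def nz jj_def U_def)
  have zc: "?B z c = uu / 2 * zz - uz" by (simp add: c bilin_simps ss)
  \<comment> \<open>This factor \<open>jj\<close> cancels the division by \<open>jj\<close> inside
    \<open>m\<close>, so \<open>cm\<close> has no \<open>jj\<close> in the denominator.\<close>
  have cc: "?B c c = uu * jj" by (simp add: c bilin_simps ss jj algebra_simps)
  have cy: "?B c y = uu / 2 * zy - uy" by (simp add: c bilin_simps ss)
  have zm: "?B z m = - \<i> / q * zy - (uu / 2 * zz - uz) / jj"
    unfolding m bilin_diff_right bilin_scale_right zc by (simp add: ss)
  have cm: "?B c m = - \<i> / q * (uu / 2 * zy - uy) - uu"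
    unfolding m bilin_diff_right bilin_scale_right cc cy using J0 by simp
  have "nvec g w $ i = jj * (m $ i - ?B z m * U $ i) - ?B c m * (z $ i - zz / 2 * U $ i)" for i
  proof -
    have e1: "jj * (m $ i - ?B z m * U $ i) =
      - \<i> / q * (jj * (y $ i - zy * U $ i)) - (uu / 2 * z $ i - U $ i) + (uu / 2 * zz - uz) * U $ i"
      unfolding zm using J0 q0 by (simp add: m c field_simps)
    \<comment> \<open>Multiplication by \<open>q\<close> removes the last denominator that depends
      on \<open>z\<close>; expanding \<open>cJ\<close> and \<open>cz\<close> leaves a polynomial
      identity.\<close>
    have e2: "q * (jj * (m $ i - ?B z m * U $ i) - ?B c m * (z $ i - zz / 2 * U $ i)) =
      - \<i> * (jj * (y $ i - zy * U $ i)) - q * (uu / 2 * z $ i - U $ i) + q * (uu / 2 * zz - uz) * U $ i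
       + (\<i> * (uu / 2 * zy - uy) + q * uu) * (z $ i - zz / 2 * U $ i)"
      unfolding e1 cm using q0 by (simp add: field_simps)
    have "q * nvec g w $ i = - (cnj jj * (z $ i - zz / 2 * U $ i)
      - jj * (z $ i - 2 * \<i> * y $ i - cnj zz / 2 * U $ i)) / 2"
      unfolding nw using q0 by simp
    also have "\<dots> = q * (jj * (m $ i - ?B z m * U $ i) - ?B c m * (z $ i - zz / 2 * U $ i))"
      unfolding e2 cJ cz by (simp add: jj field_simps)
    finally show ?thesis using q0 by simp
  qed
  then show ?thesis
    by (simp add: vec_eq_iff w_def jj_def U_def s algebra_simps)
qed

section \<open>Vanishing of the constant term\<close>

definition rvec :: "int ^ 'n \<Rightarrow> real ^ 'n" where
  "rvec u = (\<chi> i. of_int (u $ i))"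

lemma rvec_nth [simp]: "rvec u $ i = of_int (u $ i)"
  by (simp add: rvec_def)

lemma rmat_nth [simp]: "rmat A $ i $ j = of_int (A $ i $ j)"
  by (simp add: map_matrix_def)

lemma bilin_rvec: "bilin (rmat G) (rvec u) (rvec v) = of_int (bilin G u v)"
  by (simp add: bilin_def)

lemma even_lattice_gram:
  fixes G :: "int ^ 'n::finite ^ 'n"
  assumes "even_lattice (hyp_gram G)"
  shows "transpose G = G" "even (bilin G u u)"
proof -
  have "transpose (hyp_gram G) $ Lat i $ Lat j = hyp_gram G $ Lat i $ Lat j" for i j
    using assms by (simp add: even_lattice_def)
  then show "transpose G = G"
    by (simp add: vec_eq_iff transpose_def hyp_gram_def)
  let ?x = "(\<chi> a. case a of Lat i \<Rightarrow> u $ i | _ \<Rightarrow> 0) :: int ^ 'n hyp"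
  have "lat ?x = u" by (simp add: vec_eq_iff)
  then have "bilin (hyp_gram G) ?x ?x = bilin G u u" by (simp add: bilin_hyp)
  then show "even (bilin G u u)" using assms by (metis even_lattice_def)
qed

lemma transpose_rmat: "transpose G = G \<Longrightarrow> transpose (rmat G) = rmat G"
  by (simp add: vec_eq_iff transpose_def map_matrix_def)

text \<open>The \<open>2 + n\<close> nonzero diagonal entries exhaust all indices of
  \<open>U \<oplus> L\<close>, so its Gram matrix is nonsingular. A kernel vector of
  \<open>rmat G\<close>, extended by zero along \<open>e\<close> and \<open>f\<close>, would lie in
  its kernel.\<close>

lemma signature_imp_invertible:
  fixes G :: "int ^ 'n::finite ^ 'n"
  assumes "has_signature (rmat (hyp_gram G)) 2 CARD('n)"
  shows "invertible (rmat G)"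
proof -
  let ?S = "rmat (hyp_gram G)"
  obtain P :: "real ^ 'n hyp ^ 'n hyp" where P: "invertible P"
    and off: "\<And>i j. i \<noteq> j \<Longrightarrow> (transpose P ** ?S ** P) $ i $ j = 0"
    and card: "card {i. (transpose P ** ?S ** P) $ i $ i > 0} = 2"
      "card {i. (transpose P ** ?S ** P) $ i $ i < 0} = CARD('n)"
    using assms unfolding has_signature_def Let_def by blast
  let ?D = "transpose P ** ?S ** P"
  have "CARD('n hyp) = CARD('n) + 2"
  proof -
    have "card (range (Lat :: 'n \<Rightarrow> _)) = CARD('n)" by (rule card_image) (simp add: inj_on_def)
    moreover have "card ({HE, HF} \<union> range (Lat :: 'n \<Rightarrow> _)) = card {HE, HF :: 'n hyp} + card (range (Lat :: 'n \<Rightarrow> _))"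
      by (rule card_Un_disjoint) auto
    ultimately show ?thesis by (simp add: UNIV_hyp)
  qed
  moreover have "card ({i. ?D $ i $ i > 0} \<union> {i. ?D $ i $ i < 0}) = 2 + CARD('n)"
    by (subst card_Un_disjoint) (auto simp: card)
  ultimately have "{i. ?D $ i $ i > 0} \<union> {i. ?D $ i $ i < 0} = UNIV"
    by (intro card_subset_eq) auto
  then have "?D $ i $ i \<noteq> 0" for i by (metis (mono_tags, lifting) Un_iff UNIV_I less_irrefl mem_Collect_eq)
  then have "det ?D \<noteq> 0" using off by (simp add: det_diagonal)
  then have "det ?S \<noteq> 0" by (simp add: det_mul)
  then have inj: "x = 0" if "?S *v x = 0" for x
    using that by (metis invertible_det_nz invertible_left_inverse matrix_left_invertible_ker)
  have "x = 0" if x: "rmat G *v x = 0" for x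
  proof -
    let ?x = "(\<chi> a. case a of Lat i \<Rightarrow> x $ i | _ \<Rightarrow> 0) :: real ^ 'n hyp"
    have "(rmat G *v x) $ i = 0" for i using x by simp
    then have "?S *v ?x = 0"
      by (simp add: vec_eq_iff forall_hyp matrix_vector_mult_def sum_UNIV_hyp hyp_gram_def)
    then have "?x $ Lat i = 0" for i using inj by (metis zero_index)
    then show ?thesis by (simp add: vec_eq_iff)
  qed
  then show ?thesis by (metis invertible_left_inverse matrix_left_invertible_ker)
qed

text \<open>The division is exact on an even lattice, which makes the transvection integral.\<close>

definition int_eichler :: "int ^ 'n ^ 'n \<Rightarrow> int ^ 'n \<Rightarrow> int ^ 'n hyp ^ 'n hyp" where
  "int_eichler G u = eichler G u (bilin G u u div 2)"

lemma cmat_int_eichler: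
  fixes G :: "int ^ 'n::finite ^ 'n"
  assumes "even_lattice (hyp_gram G)"
  shows "cmat (rmat (int_eichler G u)) = real_eichler (rmat G) (rvec u)"
proof -
  have half: "bilin (rmat G) (rvec u) (rvec u) / 2 = real_of_int (bilin G u u div 2)"
    using even_lattice_gram(2)[OF assms, of u] by (simp add: bilin_rvec real_of_int_div)
  have "(cmat (rmat G) *v cvec (rvec u)) $ i = of_int ((G *v u) $ i)" for i
    by (simp add: matrix_vector_mult_def)
  then show ?thesis
    unfolding int_eichler_def real_eichler_def half
    by (simp add: vec_eq_iff forall_hyp eichler_def)
qed

lemma int_eichler_add:
  fixes G :: "int ^ 'n::finite ^ 'n"
  assumes "even_lattice (hyp_gram G)"
  shows "int_eichler G u ** int_eichler G v = int_eichler G (u + v)"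
proof -
  obtain p q where pq: "bilin G u u = 2 * p" "bilin G v v = 2 * q"
    using even_lattice_gram(2)[OF assms] by (meson evenE)
  have "bilin G (u + v) (u + v) = 2 * (p + q + bilin G v u)"
    using bilin_commute[OF even_lattice_gram(1)[OF assms], of u v] by (simp add: bilin_simps pq)
  then show ?thesis by (simp add: int_eichler_def eichler_add pq)
qed

lemma int_eichler_0: "int_eichler G 0 = mat 1" for G :: "int ^ 'n::finite ^ 'n"
  by (simp add: int_eichler_def eichler_0 bilin_matrix)

text \<open>The transvection along \<open>- u\<close> is the inverse. As both map \<open>D\<close>
  into itself, the image of \<open>D\<close> is all of \<open>D\<close>.\<close>

lemma int_eichler_in_Oplus:
  fixes G :: "int ^ 'n::finite ^ 'n"
  assumes G: "even_lattice (hyp_gram G)" and D: "D \<in> components (period_cone (rmat G))"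
  shows "int_eichler G u \<in> carrier (Oplus G D)"
proof -
  note g = even_lattice_gram[OF G]
  have inv: "int_eichler G u ** int_eichler G (- u) = mat 1" for u
    by (simp add: int_eichler_add[OF G] int_eichler_0)
  have "invertible (int_eichler G u)"
    unfolding invertible_def using inv[of u] inv[of "- u"] by auto
  moreover have "transpose (int_eichler G u) ** hyp_gram G ** int_eichler G u = hyp_gram G"
    using g by (intro isometry_matrix_eq) (simp add: int_eichler_def eichler_isometry)
  moreover have "(\<lambda>Z. cmat (rmat (int_eichler G u)) *v Z) ` D = D"
  proof -
    have mem: "cmat (rmat (int_eichler G u)) *v Z \<in> D" if "Z \<in> D" for Z u
      unfolding cmat_int_eichler[OF G] by (rule real_eichler_component[OF D transpose_rmat[OF g(1)] that])
    have "cmat (rmat (int_eichler G u)) ** cmat (rmat (int_eichler G (- u))) = cmat (rmat (int_eichler G u ** int_eichler G (- u)))"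
      by (simp add: vec_eq_iff matrix_matrix_mult_def)
    also have "\<dots> = mat 1"
      unfolding inv by (simp add: vec_eq_iff mat_def)
    finally have "Z = cmat (rmat (int_eichler G u)) *v (cmat (rmat (int_eichler G (- u))) *v Z)" for Z
      by (simp add: matrix_vector_mul_assoc)
    then show ?thesis using mem by (blast intro: image_eqI)
  qed
  ultimately show ?thesis by (simp add: Oplus_def)
qed

text \<open>Pigeonhole: infinitely many multiples of \<open>u\<close> give transvections in one
  right coset, and quotients within a coset are again transvections, along the difference of the
  multiples, lying in \<open>\<Gamma>\<close>.\<close>

lemma infinite_int_eichler_in_finite_index:
  fixes G :: "int ^ 'n::finite ^ 'n"
  assumes G: "even_lattice (hyp_gram G)" and D: "D \<in> components (period_cone (rmat G))"
    and \<Gamma>: "subgroup \<Gamma> (Oplus G D)" and fin: "finite (rcosets\<^bsub>Oplus G D\<^esub> \<Gamma>)"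
  shows "infinite {t. int_eichler G (t *s u) \<in> \<Gamma>}"
proof -
  define f where "f t = \<Gamma> #>\<^bsub>Oplus G D\<^esub> int_eichler G (t *s u)" for t
  have "range f \<subseteq> rcosets\<^bsub>Oplus G D\<^esub> \<Gamma>"
    using int_eichler_in_Oplus[OF G D] by (auto simp: f_def RCOSETS_def)
  then have "finite (range f)" using fin finite_subset by blast
  then obtain t0 where t0: "infinite {t. f t = f t0}"
    using pigeonhole_infinite[of "UNIV :: int set" f] infinite_UNIV_int by auto
  have "int_eichler G ((t - t0) *s u) \<in> \<Gamma>" if "f t = f t0" for t
  proof -
    have "mat 1 \<in> \<Gamma>" using subgroup.one_closed[OF \<Gamma>] by (simp add: Oplus_def)
    then have "int_eichler G (t *s u) \<in> f t"
      by (force simp: f_def r_coset_def Oplus_def)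
    then have "int_eichler G (t *s u) \<in> f t0" using that by simp
    then obtain h where h: "h \<in> \<Gamma>" "int_eichler G (t *s u) = h ** int_eichler G (t0 *s u)"
      by (auto simp: f_def r_coset_def Oplus_def)
    have "int_eichler G (t *s u) ** int_eichler G (- (t0 *s u)) = int_eichler G ((t - t0) *s u)"
      by (simp add: int_eichler_add[OF G] vec_eq_iff left_diff_distrib
          arg_cong[of _ _ "int_eichler G"])
    moreover have "h ** int_eichler G (t0 *s u) ** int_eichler G (- (t0 *s u)) = h"
      by (simp add: int_eichler_add[OF G] int_eichler_0 flip: matrix_mul_assoc)
    ultimately show ?thesis using h by simp
  qed
  then have "(\<lambda>t. t - t0) ` {t. f t = f t0} \<subseteq> {t. int_eichler G (t *s u) \<in> \<Gamma>}" by auto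
  moreover have "infinite ((\<lambda>t. t - t0) ` {t. f t = f t0})"
    using t0 by (simp add: finite_image_iff inj_on_def)
  ultimately show ?thesis using finite_subset by blast
qed

section \<open>Automorphy data of integral transvections in closed form\<close>

lemma J_int_eichler:
  fixes G :: "int ^ 'n::finite ^ 'n"
  assumes "even_lattice (hyp_gram G)"
  shows "J (rmat G) (rmat (int_eichler G u)) z = eichler_J (rmat G) (cvec (rvec u)) z"
  by (simp add: J_def cmat_int_eichler[OF assms] real_eichler_phi)

lemma act_int_eichler:
  fixes G :: "int ^ 'n::finite ^ 'n"
  assumes "even_lattice (hyp_gram G)"
  shows "act (rmat G) (rmat (int_eichler G u)) z = eichler_act (rmat G) (cvec (rvec u)) z"
proof -
  have "(real_eichler (rmat G) (rvec u) *v phi (rmat G) z) $ Lat i =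
      (z - (bilin (cmat (rmat G)) z z / 2) *s cvec (rvec u)) $ i" for i
    using real_eichler_phi(3)[of "rmat G" "rvec u" z] by (metis lat_nth)
  then show ?thesis
    by (simp add: act_def J_int_eichler[OF assms] cmat_int_eichler[OF assms] eichler_act_def vec_eq_iff
        diff_divide_distrib)
qed

text \<open>The quotient rule applied to \<open>eichler_act\<close> and multiplied by
  \<open>eichler_J\<close>.\<close>

definition eichler_lam :: "real ^ 'n ^ 'n \<Rightarrow> complex ^ 'n \<Rightarrow> complex ^ 'n \<Rightarrow> 'n \<Rightarrow> 'n \<Rightarrow> complex" where
  "eichler_lam g u z i j = (if i = j then 1 else 0) - (cmat g *v z) $ j * u $ i
     - (z $ i - bilin (cmat g) z z / 2 * u $ i) * (cmat g *v eichler_grad g u z) $ j / eichler_J g u z"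

lemma lam_int_eichler:
  fixes G :: "int ^ 'n::finite ^ 'n"
  assumes G: "even_lattice (hyp_gram G)" and J: "eichler_J (rmat G) (cvec (rvec u)) z \<noteq> 0"
  shows "lam (rmat G) (rmat (int_eichler G u)) z i j = eichler_lam (rmat G) (cvec (rvec u)) z i j"
proof -
  let ?g = "cmat (rmat G)" and ?U = "cvec (rvec u)"
  define zz zu uu gz gu gjj where d: "zz = bilin ?g z z" "zu = bilin ?g z ?U" "uu = bilin ?g ?U ?U"
    "gz = (?g *v z) $ j" "gu = (?g *v ?U) $ j" "gjj = ?g $ j $ j"
  have g: "transpose ?g = ?g"
    by (intro transpose_cmat transpose_rmat even_lattice_gram[OF G])
  \<comment> \<open>Along axis \<open>j\<close> the denominator, like the numerator below, is at
    most quadratic in \<open>t\<close>, so one quotient rule at 0 suffices.\<close>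
  have JJ: "eichler_J (rmat G) ?U (z + axis j t) = 1 - (zu + t * gu) + uu * (zz + 2 * t * gz + t\<^sup>2 * gjj) / 4" for t
    unfolding eichler_J_def bilin_add_axis[OF g] by (simp add: bilin_add_left bilin_axis_left d)
  have J0: "1 - zu + uu * zz / 4 \<noteq> 0" using J by (simp add: eichler_J_def d)
  have axis: "axis j t $ i = (if i = j then t else 0)" for t :: complex
    by (simp add: axis_def)
  have act: "act (rmat G) (rmat (int_eichler G u)) (z + axis j t) $ i =
      (z $ i + (if i = j then t else 0) - (zz + 2 * t * gz + t\<^sup>2 * gjj) / 2 * ?U $ i)
        / (1 - (zu + t * gu) + uu * (zz + 2 * t * gz + t\<^sup>2 * gjj) / 4)" for t
    unfolding act_int_eichler[OF G] eichler_act_def JJ bilin_add_axis[OF g] vector_smult_component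
      vector_minus_component vector_add_component axis d[symmetric]
    by simp
  have "((\<lambda>t. act (rmat G) (rmat (int_eichler G u)) (z + axis j t) $ i) has_field_derivative
      (((if i = j then 1 else 0) - gz * ?U $ i) * (1 - zu + uu * zz / 4)
        - (z $ i - zz / 2 * ?U $ i) * (uu / 2 * gz - gu)) / (1 - zu + uu * zz / 4)\<^sup>2) (at 0)"
  proof -
    have "((\<lambda>t. z $ i + (if i = j then t else 0) - (zz + 2 * t * gz + t\<^sup>2 * gjj) / 2 * ?U $ i)
        has_field_derivative (if i = j then 1 else 0) - gz * ?U $ i) (at 0)"
      by (cases "i = j") (auto intro!: derivative_eq_intros)
    moreover have "((\<lambda>t. 1 - (zu + t * gu) + uu * (zz + 2 * t * gz + t\<^sup>2 * gjj) / 4)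
        has_field_derivative uu / 2 * gz - gu) (at 0)"
      by (auto intro!: derivative_eq_intros)
    ultimately show ?thesis
      unfolding act using J0 by (auto dest: DERIV_divide simp: power2_eq_square)
  qed
  then have deriv: "deriv (\<lambda>t. act (rmat G) (rmat (int_eichler G u)) (z + axis j t) $ i) 0 =
      (((if i = j then 1 else 0) - gz * ?U $ i) * (1 - zu + uu * zz / 4)
        - (z $ i - zz / 2 * ?U $ i) * (uu / 2 * gz - gu)) / (1 - zu + uu * zz / 4)\<^sup>2"
    by (rule DERIV_imp_deriv)
  have grad: "(?g *v eichler_grad (rmat G) ?U z) $ j = uu / 2 * gz - gu"
    by (simp add: eichler_grad_def matrix_vector_mult_diff_distrib vector_scalar_commute d)
  have J: "eichler_J (rmat G) ?U z = 1 - zu + uu * zz / 4" by (simp add: eichler_J_def d)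
  have quotient: "w * ((p * w - q * r) / w\<^sup>2) = p - q * r / w" if "w \<noteq> 0" for w p q r :: complex
    using that by (simp add: field_simps power2_eq_square)
  show ?thesis
    unfolding lam_def J_int_eichler[OF G] eichler_lam_def deriv grad J d(1)[symmetric] d(4)[symmetric]
    by (rule quotient[OF J0])
qed

section \<open>Holomorphy in \<open>z\<close> and polynomiality in the vector variable\<close>

lemma holomorphic_on_bilin [holomorphic_intros]:
  assumes "\<And>i. (\<lambda>s. f s $ i) holomorphic_on S" "\<And>i. (\<lambda>s. h s $ i) holomorphic_on S"
  shows "(\<lambda>s. bilin g (f s) (h s)) holomorphic_on S"
  unfolding bilin_def by (intro holomorphic_intros assms)

lemma holomorphic_on_matrix_nth [holomorphic_intros]:
  assumes "\<And>i. (\<lambda>s. f s $ i) holomorphic_on S"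
  shows "(\<lambda>s. (A *v f s) $ j) holomorphic_on S"
  unfolding matrix_vector_mult_def vec_lambda_beta by (intro holomorphic_intros assms)

lemma line_poly_bilin:
  assumes "\<And>i. line_poly (\<lambda>v. f v $ i)"
  shows "line_poly (\<lambda>v. bilin g x (f v))"
  unfolding bilin_def by (intro line_poly_intros assms)

lemma line_poly_matrix_nth:
  assumes "\<And>i. line_poly (\<lambda>v. f v $ i)"
  shows "line_poly (\<lambda>v. (A *v f v) $ j)"
  unfolding matrix_vector_mult_def vec_lambda_beta by (intro line_poly_intros assms)

text \<open>\<open>J\<^sup>2 \<cdot> D(\<gamma>z) \<cdot> (v - g\<^sup>-\<^sup>1 d log J)\<close>, which is \<open>n(\<gamma>z)\<close> at \<open>v = n(z)\<close>.\<close>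

definition nvec_transform ::
    "real ^ 'n ^ 'n \<Rightarrow> complex ^ 'n \<Rightarrow> complex ^ 'n \<Rightarrow> complex ^ 'n \<Rightarrow> complex ^ 'n" where
  "nvec_transform g u z v =
    (let c = eichler_grad g u z; m = v - (1 / eichler_J g u z) *s c in
      eichler_J g u z *s (m - bilin (cmat g) z m *s u)
        - bilin (cmat g) c m *s (z - (bilin (cmat g) z z / 2) *s u))"

lemma
  assumes "\<And>i. (\<lambda>s. f s $ i) holomorphic_on S"
  shows holomorphic_eichler_J: "(\<lambda>s. eichler_J g u (f s)) holomorphic_on S"
    and holomorphic_eichler_grad: "(\<lambda>s. eichler_grad g u (f s) $ i) holomorphic_on S"
  unfolding eichler_J_def eichler_grad_def vector_minus_component vector_smult_component
  by (intro holomorphic_intros assms; simp)+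

lemma
  assumes f: "\<And>i. (\<lambda>s. f s $ i) holomorphic_on S" and J: "\<And>s. s \<in> S \<Longrightarrow> eichler_J g u (f s) \<noteq> 0"
  shows holomorphic_eichler_act: "(\<lambda>s. eichler_act g u (f s) $ i) holomorphic_on S"
    and holomorphic_eichler_lam: "(\<lambda>s. eichler_lam g u (f s) i j) holomorphic_on S"
    and holomorphic_nvec_transform: "(\<lambda>s. nvec_transform g u (f s) v $ i) holomorphic_on S"
proof -
  note hol = holomorphic_eichler_J[OF f] holomorphic_eichler_grad[OF f] f
  show "(\<lambda>s. eichler_act g u (f s) $ i) holomorphic_on S"
    and "(\<lambda>s. eichler_lam g u (f s) i j) holomorphic_on S"
    unfolding eichler_act_def eichler_lam_def vector_minus_component vector_smult_component
    by (intro holomorphic_intros hol; simp add: J; fail)+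
  have "(\<lambda>s. (v - (1 / eichler_J g u (f s)) *s eichler_grad g u (f s)) $ i) holomorphic_on S" for i
    unfolding vector_minus_component vector_smult_component
    by (intro holomorphic_intros hol) (simp add: J)
  note m = this holomorphic_on_bilin[OF f this]
    holomorphic_on_bilin[OF holomorphic_eichler_grad[OF f] this]
  show "(\<lambda>s. nvec_transform g u (f s) v $ i) holomorphic_on S"
    unfolding nvec_transform_def Let_def vector_minus_component[of "_ *s _"] vector_smult_component
      vector_minus_component[of _ "_ *s u"]
    by (intro holomorphic_intros hol m) simp
qed

lemma line_poly_nvec_transform: "line_poly (\<lambda>v. nvec_transform g u z v $ i)"
  unfolding nvec_transform_def Let_def vector_minus_component vector_smult_component
  by (intro line_poly_intros line_poly_bilin; simp only: vector_minus_component vector_smult_component;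
      intro line_poly_intros)

text \<open>Invariance is an identity at \<open>v = n(z)\<close>, which the relation lemma promotes
  to all \<open>v\<close>. At \<open>v = g\<inverse> d log J\<close> the transformed vector is 0,
  where only the constant terms survive, and these vanish by \<open>a0\<close>.\<close>

lemma eichler_vanishing:
  fixes G :: "int ^ 'n::finite ^ 'n"
  assumes G: "even_lattice (hyp_gram G)" and D: "D \<in> components (period_cone (rmat G))"
  defines "g \<equiv> rmat G" and "C \<equiv> tube (rmat G) D"
  assumes inv: "\<And>z I. z \<in> C \<Longrightarrow> length I = s \<Longrightarrow> slash g (rmat (int_eichler G u)) k s F z I = F z I"
    and a: "nu_expansion g C s F a" and a0: "\<And>I. a I (\<lambda>_. 0) = (\<lambda>_. 0)"
    and z0: "z0 \<in> C" "length I = s" and J0: "eichler_J g (cvec (rvec u)) z0 \<noteq> 0"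
  shows "(\<Sum>\<alpha> | a I \<alpha> \<noteq> (\<lambda>_. 0). a I \<alpha> z0 * (\<Prod>j\<in>UNIV.
    (cmat g *v ((1 / eichler_J g (cvec (rvec u)) z0) *s eichler_grad g (cvec (rvec u)) z0)) $ j ^ \<alpha> j)) = 0"
proof -
  define U where "U = cvec (rvec u)"
  have g: "transpose g = g"
    unfolding g_def by (intro transpose_rmat even_lattice_gram[OF G])
  have pos: "bilin g (im_vec z) (im_vec z) > 0" if "z \<in> C" for z
    using that by (simp add: C_def tube_def g_def)
  define P where "P z v I = (\<Sum>\<alpha> | a I \<alpha> \<noteq> (\<lambda>_. 0). a I \<alpha> z * (\<Prod>j\<in>UNIV. (cmat g *v v) $ j ^ \<alpha> j))" for z v I
  \<comment> \<open>The slash operator applied to \<open>P\<close>, with \<open>n(\<gamma>z)\<close>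
    replaced by its expression in an independent variable \<open>v\<close>.\<close>
  define R where "R z v = eichler_J g U z powi (- k) * (\<Sum>is | length is = s.
      P (eichler_act g U z) (nvec_transform g U z v) is * (\<Prod>r<s. eichler_lam g U z (is ! r) (I ! r)))" for z v
  \<comment> \<open>Away from the zeros of the factor, \<open>R\<close> is holomorphic in
    \<open>z\<close>; the set is open and contains \<open>z0\<close>.\<close>
  define C' where "C' = {z \<in> C. eichler_J g U z \<noteq> 0}"
  have hol: "holo_on (a I \<alpha>) C" for I \<alpha> using a by (simp add: nu_expansion_def)
  have FP: "F z I = P z (nvec g z) I" if "z \<in> C" "length I = s" for z I
    unfolding P_def by (rule nu_expansion_nvec[OF g pos a]) (use that in auto)
  have act: "eichler_act g U z \<in> C" if "z \<in> C'" for z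
    using eichler_act_in_tube[OF D] that g by (auto simp: C'_def C_def U_def g_def)
  have "P z0 v I - R z0 v = 0" for v
  proof (rule nvec_polynomial_relation[where Q = "\<lambda>z v. P z v I - R z v"])
    have "open C" unfolding C_def by (rule open_tube[OF D]) (use g in \<open>simp add: g_def\<close>)
    moreover have "continuous_on C (eichler_J g U)"
      unfolding eichler_J_def by (intro continuous_intros) auto
    ultimately have "open (C \<inter> eichler_J g U -` (- {0}))"
      by (intro continuous_open_preimage) auto
    also have "C \<inter> eichler_J g U -` (- {0}) = C'" by (auto simp: C'_def)
    finally show "open C'" .
    show "z0 \<in> C'" using z0 J0 by (simp add: C'_def U_def)
    show "bilin g (im_vec z0) (im_vec z0) > 0" using pos z0 by simp
    show "line_poly (\<lambda>v. P z0 v I - R z0 v)"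
      unfolding P_def R_def
      by (intro line_poly_intros line_poly_linear line_poly_matrix_nth line_poly_nvec_transform)
  next
    fix z assume z: "z \<in> C'"
    then have zC: "z \<in> C" and J: "eichler_J g U z \<noteq> 0" by (auto simp: C'_def)
    have "nvec g (eichler_act g U z) = nvec_transform g U z (nvec g z)"
      using nvec_eichler_act[OF g J[unfolded U_def] pos[OF zC]]
      by (simp add: nvec_transform_def Let_def U_def)
    then have FR: "F (eichler_act g U z) is = P (eichler_act g U z) (nvec_transform g U z (nvec g z)) is"
      if "length is = s" for "is"
      using FP[OF act[OF z] that] by simp
    have "slash g (rmat (int_eichler G u)) k s F z I = R z (nvec g z)"
      unfolding slash_def R_def g_def J_int_eichler[OF G] act_int_eichler[OF G]
        lam_int_eichler[OF G J[unfolded g_def U_def]] U_def[symmetric]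
      by (simp add: FR g_def[symmetric])
    then show "P z (nvec g z) I - R z (nvec g z) = 0"
      using inv[OF zC z0(2)] FP[OF zC z0(2)] by simp
  next
    fix v a' b and S :: "complex set"
    assume S: "open S" "\<And>s. s \<in> S \<Longrightarrow> a' + s *s b \<in> C'"
    have line: "(\<lambda>s. (a' + s *s b) $ i) holomorphic_on S" for i
      by (simp, intro holomorphic_intros)
    have J: "eichler_J g U (a' + s *s b) \<noteq> 0" if "s \<in> S" for s
      using S(2)[OF that] by (simp add: C'_def)
    have C: "(\<lambda>s. a' + s *s b) ` S \<subseteq> C" "(\<lambda>s. eichler_act g U (a' + s *s b)) ` S \<subseteq> C"
      using S(2) act by (auto simp: C'_def)
    show "(\<lambda>s. P (a' + s *s b) v I - R (a' + s *s b) v) holomorphic_on S"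
      unfolding P_def R_def
      by (intro holomorphic_intros holo_on_compose[OF hol line C(1)]
          holo_on_compose[OF hol holomorphic_eichler_act[OF line J] C(2)]
          holomorphic_eichler_J[OF line] holomorphic_eichler_lam[OF line J]
          holomorphic_nvec_transform[OF line J]) (use J in auto)
  qed
  then have "P z0 ((1 / eichler_J g U z0) *s eichler_grad g U z0) I
      = R z0 ((1 / eichler_J g U z0) *s eichler_grad g U z0)" by simp
  also have "\<dots> = 0"
  proof -
    have "nvec_transform g U z0 ((1 / eichler_J g U z0) *s eichler_grad g U z0) = 0"
      by (simp add: nvec_transform_def bilin_matrix vec_eq_iff)
    moreover have "P z 0 is = 0" for z "is"
      unfolding P_def
    proof (rule sum.neutral, rule ballI)
      fix \<alpha> assume "\<alpha> \<in> {\<alpha>. a is \<alpha> \<noteq> (\<lambda>_. 0)}"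
      then have "\<alpha> \<noteq> (\<lambda>_. 0)" using a0 by auto
      then obtain j where "\<alpha> j \<noteq> 0" by auto
      then show "a is \<alpha> z * (\<Prod>j\<in>UNIV. (cmat g *v 0) $ j ^ \<alpha> j) = 0"
        by (auto intro!: prod_zero)
    qed
    ultimately show ?thesis by (simp add: R_def)
  qed
  finally show ?thesis by (simp add: P_def U_def)
qed

text \<open>The alternative \<open>eichler_J g u z = 0\<close> absorbs the poles: after clearing
  denominators, \<open>V\<close> on a line says that the polynomial \<open>J * r\<close>
  vanishes.\<close>

lemma line_eichler_vanishing:
  fixes g :: "real ^ 'n::finite ^ 'n" and p :: "('n \<Rightarrow> nat) \<Rightarrow> complex" and A z
  defines "V \<equiv> \<lambda>u. eichler_J g u z = 0 \<or> (\<Sum>\<alpha>\<in>A. p \<alpha> *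
    (\<Prod>j\<in>UNIV. (cmat g *v ((1 / eichler_J g u z) *s eichler_grad g u z)) $ j ^ \<alpha> j)) = 0"
  assumes A: "finite A" and inf: "infinite {t. V (a + t *s b)}"
  shows "V (a + t *s b)"
proof -
  have lin: "(\<lambda>t. (a + t *s b) $ i) \<in> range poly" for i
    by (simp add: poly_fun_intros)
  have J: "(\<lambda>t. eichler_J g (a + t *s b) z) \<in> range poly"
    unfolding eichler_J_def bilin_def divide_inverse by (intro poly_fun_intros lin)
  have c: "(\<lambda>t. (cmat g *v eichler_grad g (a + t *s b) z) $ j) \<in> range poly" for j
    unfolding eichler_grad_def bilin_def divide_inverse matrix_vector_mult_def vec_lambda_beta
      vector_minus_component vector_smult_component
    by (intro poly_fun_intros lin)
  from clear_denominators[OF A, where c = "\<lambda>j t. (cmat g *v eichler_grad g (a + t *s b) z) $ j" and p = p, OF c J]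
  obtain N r where r: "r \<in> range poly" "\<And>t. eichler_J g (a + t *s b) z \<noteq> 0 \<Longrightarrow>
      eichler_J g (a + t *s b) z ^ N * (\<Sum>\<alpha>\<in>A. p \<alpha> * (\<Prod>j\<in>UNIV.
        ((cmat g *v eichler_grad g (a + t *s b) z) $ j / eichler_J g (a + t *s b) z) ^ \<alpha> j)) = r t"
    by blast
  have V: "V (a + t *s b) \<longleftrightarrow> eichler_J g (a + t *s b) z * r t = 0" for t
  proof (cases "eichler_J g (a + t *s b) z = 0")
    case False
    then show ?thesis
      using r(2)[OF False] by (simp add: V_def vector_scalar_commute flip: r(2))
  qed (simp add: V_def)
  have "(\<lambda>t. eichler_J g (a + t *s b) z * r t) \<in> range poly"
    by (intro poly_fun_intros J r(1))
  then show ?thesis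
    using poly_fun_zero inf unfolding V by blast
qed

text \<open>Integers form an infinite subset of each coordinate line, so one coordinate at a time
  can be released from integral to arbitrary complex values.\<close>

lemma integer_points_line_closed:
  fixes V :: "complex ^ 'n::finite \<Rightarrow> bool"
  assumes line: "\<And>a b t. infinite {t. V (a + t *s b)} \<Longrightarrow> V (a + t *s b)"
    and int: "\<And>u. V (cvec (rvec u))"
  shows "V u"
proof -
  \<comment> \<open>\<open>X\<close> collects the coordinates that have already been
    released.\<close>
  have "\<forall>i. i \<notin> X \<longrightarrow> u $ i \<in> \<int> \<Longrightarrow> V u" if "finite X" for X :: "'n set"
    using that
  proof (induction X arbitrary: u rule: finite_induct)
    case empty
    then have "\<forall>i. \<exists>m. u $ i = of_int m" by (auto elim: Ints_cases)
    then obtain m where "\<And>i. u $ i = of_int (m i)" by metis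
    then have "u = cvec (rvec (\<chi> i. m i))" by (simp add: vec_eq_iff)
    then show ?case using int by metis
  next
    case (insert j X)
    define w where "w = (\<chi> i. if i = j then 0 else u $ i)"
    have eq: "(w + t *s axis j 1) $ i = (if i = j then t else u $ i)" for t i
      by (simp add: w_def axis_def)
    have "V (w + of_int m *s axis j 1)" for m
      by (rule insert.IH) (use insert.prems in \<open>simp only: eq, auto\<close>)
    then have "range of_int \<subseteq> {t. V (w + t *s axis j 1)}" by auto
    then have "infinite {t. V (w + t *s axis j 1)}"
      using finite_subset infinite_UNIV_int
      by (metis finite_imageD inj_on_def of_int_eq_iff)
    from line[OF this, of "u $ j"] have "V (w + u $ j *s axis j 1)" .
    moreover have "w + u $ j *s axis j 1 = u" by (simp only: vec_eq_iff eq) simp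
    ultimately show ?case by simp
  qed
  from this[of UNIV] show ?thesis by simp
qed

text \<open>The logarithmic gradients reach every \<open>x\<close> with
  \<open>\<langle>x, x\<rangle> h x \<noteq> 0\<close>. The product of \<open>f\<close> with this
  polynomial is thus identically zero, and the anisotropic \<open>y\<close> ensures that the second
  factor can be cancelled.\<close>

lemma eichler_points_dense:
  fixes g :: "real ^ 'n::finite ^ 'n"
  assumes g: "transpose g = g" and f: "line_poly f"
    and y: "bilin (cmat g) y y \<noteq> 0"
    and zero: "\<And>u. eichler_J g u z \<noteq> 0 \<Longrightarrow> f ((1 / eichler_J g u z) *s eichler_grad g u z) = 0"
  shows "f x = 0"
proof -
  let ?B = "bilin (cmat g)"
  have comm: "?B v w = ?B w v" for v w by (rule bilin_commute[OF transpose_cmat[OF g]])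
  \<comment> \<open>\<open>u = 2 w / \<langle>w, w\<rangle>\<close> gives \<open>g\<^sup>-\<^sup>1 d log J = 2 (z - w) / \<langle>z - w, z - w\<rangle>\<close>; solving for \<open>w\<close> needs \<open>\<langle>x, x\<rangle> \<noteq> 0\<close>
    and \<open>h x = \<langle>x, x\<rangle> \<langle>w, w\<rangle> \<noteq> 0\<close>.\<close>
  define h where "h x = ?B z z * ?B x x - 4 * ?B z x + 4" for x
  have *: "f x * (?B x x * h x) = 0" for x
  proof (cases "?B x x = 0 \<or> h x = 0")
    case False
    define xx where "xx = ?B x x"
    define w where "w = z - (2 / xx) *s x"
    define ww where "ww = ?B w w"
    define u where "u = (2 / ww) *s w"
    have xx: "xx \<noteq> 0" and h: "h x \<noteq> 0" using False by (auto simp: xx_def)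
    have ww: "ww = h x / xx"
      unfolding ww_def w_def h_def using xx
      by (simp add: bilin_simps comm[of x z] flip: xx_def) (simp add: field_simps)
    then have ww0: "ww \<noteq> 0" and hh: "ww * xx = ?B z z * xx - 4 * ?B z x + 4"
      using h xx by (simp_all add: h_def xx_def)
    have uu: "?B u u = 4 / ww"
      using ww0 by (simp add: u_def bilin_simps flip: ww_def)
    have zw: "?B z w = ?B z z - 2 / xx * ?B z x" by (simp add: w_def bilin_simps)
    have zu: "?B z u = 2 / ww * ?B z w" by (simp add: u_def bilin_simps)
    have J: "eichler_J g u z = 4 / (xx * ww)"
      unfolding eichler_J_def uu zu zw using ww0 xx hh by (simp add: field_simps)
    have "eichler_grad g u z = (4 / (xx * ww)) *s x"
      unfolding eichler_grad_def uu using ww0 xx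
      by (simp add: u_def w_def vec_eq_iff field_simps)
    then have "(1 / eichler_J g u z) *s eichler_grad g u z = x"
      using J xx ww0 by simp
    then show ?thesis using zero[of u] J xx ww0 by simp
  qed auto
  \<comment> \<open>\<open>h\<close> takes the value 4 at 0, so it is nonzero at all but finitely
    many multiples of \<open>y\<close>.\<close>
  obtain e where e: "e \<noteq> 0" "h (e *s y) \<noteq> 0"
  proof -
    have "(\<lambda>e. h (e *s y)) \<in> range poly"
      unfolding h_def bilin_simps by (intro poly_fun_intros)
    then obtain p where p: "\<And>e. h (e *s y) = poly p e" by (metis imageE)
    have "poly p 0 \<noteq> 0" by (simp add: h_def bilin_matrix flip: p)
    then have "finite {e. poly p e = 0}" by (intro poly_roots_finite) auto
    then have "finite (insert 0 {e. poly p e = 0})" by simp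
    then obtain e where "e \<notin> insert 0 {e. poly p e = 0}"
      using infinite_UNIV_char_0[where 'a=complex] ex_new_if_finite by blast
    then show thesis using that p by auto
  qed
  show ?thesis
  proof (rule line_poly_cancel[OF f, of "\<lambda>x. ?B x x * h x" "e *s y"])
    show "line_poly (\<lambda>x. ?B x x * h x)"
      unfolding h_def bilin_def by (intro line_poly_intros)
    show "?B (e *s y) (e *s y) * h (e *s y) \<noteq> 0"
      using e y by (simp add: bilin_simps)
  qed (rule *)
qed

text \<open>At fixed \<open>z\<close> and \<open>I\<close>, transvections in \<open>\<Gamma>\<close>
  give zeros of one polynomial in \<open>v\<close>. The zeros spread from infinitely many multiples
  of each integral vector to all integral \<open>u\<close>, then to complex \<open>u\<close>, and
  finally to every \<open>v\<close>.\<close>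

lemma ct_injective:
  fixes G :: "int ^ 'n::finite ^ 'n"
  assumes G: "even_lattice (hyp_gram G)" and sig: "has_signature (rmat (hyp_gram G)) 2 CARD('n)"
    and D: "D \<in> components (period_cone (rmat G))"
    and \<Gamma>: "subgroup \<Gamma> (Oplus G D)" and fin: "finite (rcosets\<^bsub>Oplus G D\<^esub> \<Gamma>)"
    and F: "F \<in> AHMod G D \<Gamma> k s" and ct: "ct (rmat G) (tube (rmat G) D) s F = (\<lambda>_ _. 0)"
  shows "F = (\<lambda>_ _. 0)"
proof -
  let ?g = "rmat G" and ?C = "tube (rmat G) D"
  have g: "transpose ?g = ?g" by (intro transpose_rmat even_lattice_gram[OF G])
  have pos: "bilin ?g (im_vec z) (im_vec z) > 0" if "z \<in> ?C" for z
    using that by (simp add: tube_def)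
  obtain a where a: "nu_expansion ?g ?C s F a" using F by (auto simp: AHMod_def Let_def)
  have a0: "a I (\<lambda>_. 0) = (\<lambda>_. 0)" for I
    using ct ct_eq[OF open_tube[OF D g] g signature_imp_invertible[OF sig] pos a]
    by (simp add: fun_eq_iff)
  have "F z I = 0" if z: "z \<in> ?C" "length I = s" for z I
  proof -
    let ?A = "{\<alpha>. a I \<alpha> \<noteq> (\<lambda>_. 0)}"
    let ?P = "\<lambda>v. \<Sum>\<alpha>\<in>?A. a I \<alpha> z * (\<Prod>j\<in>UNIV. (cmat ?g *v v) $ j ^ \<alpha> j)"
    let ?V = "\<lambda>u. eichler_J ?g u z = 0 \<or> ?P ((1 / eichler_J ?g u z) *s eichler_grad ?g u z) = 0"
    have finA: "finite ?A" using a by (simp add: nu_expansion_def)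
    note line = line_eichler_vanishing[OF finA, where p = "\<lambda>\<alpha>. a I \<alpha> z"]
    have int: "?V (cvec (rvec u))" for u
    proof -
      have "?V (cvec (rvec (t *s u)))" if t: "int_eichler G (t *s u) \<in> \<Gamma>" for t
      proof -
        have "slash ?g (rmat (int_eichler G (t *s u))) k s F z I = F z I"
          if "z \<in> ?C" "length I = s" for z I
          using F t that unfolding AHMod_def Let_def by blast
        from eichler_vanishing[OF G D this a a0 z] show ?thesis by blast
      qed
      moreover have "cvec (rvec (t *s u)) = 0 + of_int t *s cvec (rvec u)" for t
        by (simp add: vec_eq_iff)
      ultimately have "of_int ` {t. int_eichler G (t *s u) \<in> \<Gamma>} \<subseteq> {t. ?V (0 + t *s cvec (rvec u))}"
        by auto
      moreover have "infinite (of_int ` {t. int_eichler G (t *s u) \<in> \<Gamma>} :: complex set)"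
        using infinite_int_eichler_in_finite_index[OF G D \<Gamma> fin] by (simp add: finite_image_iff inj_on_def)
      ultimately have "infinite {t. ?V (0 + t *s cvec (rvec u))}"
        using finite_subset by blast
      \<comment> \<open>Parameter 1 recovers \<open>u\<close> itself, whose own transvection may lie
        outside \<open>\<Gamma>\<close>.\<close>
      from line[OF this, of 1] show ?thesis by simp
    qed
    have V: "?V u" for u
    proof (rule integer_points_line_closed[where V = ?V])
      show "?V (a' + t *s b)" if "infinite {t. ?V (a' + t *s b)}" for a' b t
        by (rule line[OF that])
    qed (rule int)
    have "?P v = 0" for v
    \<comment> \<open>\<open>Im z\<close> has positive norm, so it serves as the anisotropic
      vector.\<close>
    proof (rule eichler_points_dense[OF g, where f = ?P and y = "cvec (im_vec z)" and z = z])
      show "line_poly ?P" by (intro line_poly_intros line_poly_linear)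
      show "bilin (cmat ?g) (cvec (im_vec z)) (cvec (im_vec z)) \<noteq> 0"
        using pos[OF z(1)] by (simp add: bilin_cvec)
      show "?P ((1 / eichler_J ?g u z) *s eichler_grad ?g u z) = 0" if "eichler_J ?g u z \<noteq> 0" for u
        using V[of u] that by blast
    qed
    then show ?thesis using nu_expansion_nvec[OF g pos[OF z(1)] a z] by simp
  qed
  moreover have "F z I = 0" if "z \<notin> ?C \<or> length I \<noteq> s" for z I
    using F that by (auto simp: AHMod_def Let_def supported_def)
  ultimately show ?thesis by (intro ext) blast
qed

theorem theorem1p1:
  fixes G :: "int ^ 'n::finite ^ 'n"
    and D :: "(complex ^ 'n hyp) set"
    and \<Gamma> :: "(int ^ 'n hyp ^ 'n hyp) set"
    and k :: int and s :: nat
  assumes "even_lattice (hyp_gram G)"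
    and "has_signature (rmat (hyp_gram G)) 2 CARD('n)"
    and "D \<in> components (period_cone (rmat G))"
    and "subgroup \<Gamma> (Oplus G D)"
    and "finite (rcosets\<^bsub>Oplus G D\<^esub> \<Gamma>)"
  shows "linear_iso_between (ct (rmat G) (tube (rmat G) D) s)
           (AHMod G D \<Gamma> k s) (QMod G D \<Gamma> k s)"
proof (rule linear_iso_between_ct)
  show g: "transpose (rmat G) = rmat G"
    by (intro transpose_rmat even_lattice_gram[OF assms(1)])
  show "open (tube (rmat G) D)" by (rule open_tube[OF assms(3) g])
  show "invertible (rmat G)" by (rule signature_imp_invertible[OF assms(2)])
qed (rule ct_injective[OF assms])

end
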